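(* Let $1<p<\infty$ and $0<s<1$. Let $\Omega\subset\mathbb{R}^N$ be an open set such that the embedding $\mathcal{D}_0^{s,p}(\Omega)\hookrightarrow L^1(\Omega)$ is compact, and let $w_{s,p,\Omega}$ be the $(s,p)$-torsion function on $\Omega$. Then $$\int_\Omega\frac{|u|^p}{w_{s,p,\Omega}^{p-1}}\,dx\le\iint_{\mathbb{R}^{2N}}\frac{|u(x)-u(y)|^p}{|x-y|^{N+sp}}\,dx\,dy,\qquad\text{for all }u\in\mathcal{D}_0^{s,p}(\Omega).$$
   Context: $C_0^\infty(\Omega)$ is the set of smooth functions with compact support in $\Omega$ (extended by $0$ to $\mathbb{R}^N$). $\mathcal{D}_0^{s,p}(\Omega)$ is the completion of $C_0^\infty(\Omega)$ with respect to the norm $[u]_{s,p}=\Big(\iint_{\mathbb{R}^{2N}}\frac{|u(x)-u(y)|^p}{|x-y|^{N+sp}}\,dx\,dy\Big)^{1/p}$. The embedding into $L^1(\Omega)$ is compact if the inclusion of $C_0^\infty(\Omega)$ into $L^1(\Omega)$ extends to a compact operator from $\mathcal{D}_0^{s,p}(\Omega)$ to $L^1(\Omega)$; in this case elements of $\mathcal{D}_0^{s,p}(\Omega)$ are functions, extended by $0$ outside $\Omega$, and the $(s,p)$-torsion function $w_{s,p,\Omega}$ is the unique solution of $$\min_{u\in\mathcal{D}_0^{s,p}(\Omega)}\Big\{\frac1p\iint_{\mathbb{R}^{2N}}\frac{|u(x)-u(y)|^p}{|x-y|^{N+sp}}\,dx\,dy-\int_\Omega u\,dx\Big\}.$$ It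 satisfies $w_{s,p,\Omega}>0$ in $\Omega$. *)

theory Defs
  imports "HOL-Analysis.Analysis"
begin

primrec Ck :: "nat \<Rightarrow> ('a::euclidean_space \<Rightarrow> real) \<Rightarrow> bool" where
  "Ck 0 f \<longleftrightarrow> continuous_on UNIV f"
| "Ck (Suc k) f \<longleftrightarrow> (\<forall>x. f differentiable (at x)) \<and>
     (\<forall>v. Ck k (\<lambda>x. frechet_derivative f (at x) v))"

definition test_functions :: "'a::euclidean_space set \<Rightarrow> ('a \<Rightarrow> real) set" where
  "test_functions \<Omega> = {f. (\<forall>k. Ck k f) \<and>
     compact (closure {x. f x \<noteq> 0}) \<and> closure {x. f x \<noteq> 0} \<subseteq> \<Omega>}"

text \<open>On the diagonal the quotient below is \<open>0 / 0 = 0\<close>; the diagonal is a null set.\<close>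

definition gagliardo_energy :: "real \<Rightarrow> real \<Rightarrow> ('a::euclidean_space \<Rightarrow> real) \<Rightarrow> ennreal" where
  "gagliardo_energy s p u =
     (\<integral>\<^sup>+(x, y). ennreal (\<bar>u x - u y\<bar> powr p / norm (x - y) powr (real DIM('a) + s * p))
        \<partial>(lebesgue :: ('a \<times> 'a) measure))"

text \<open>Only used for test functions, whose energy is finite when \<open>0 < s < 1 < p\<close>.\<close>

definition gagliardo_norm :: "real \<Rightarrow> real \<Rightarrow> ('a::euclidean_space \<Rightarrow> real) \<Rightarrow> real" where
  "gagliardo_norm s p u = enn2real (gagliardo_energy s p u) powr (1 / p)"

text \<open>The completion of the test functions with respect to \<open>gagliardo_norm\<close>, as Cauchy
  sequences modulo sequences at distance tending to zero. Norm and vector space operations of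
  the completion are given by representatives.\<close>

definition cauchy_tests ::
    "real \<Rightarrow> real \<Rightarrow> 'a::euclidean_space set \<Rightarrow> (nat \<Rightarrow> 'a \<Rightarrow> real) set" where
  "cauchy_tests s p \<Omega> = {\<phi>. (\<forall>n. \<phi> n \<in> test_functions \<Omega>) \<and>
     (\<forall>\<epsilon>>0. \<exists>M. \<forall>m\<ge>M. \<forall>n\<ge>M. gagliardo_norm s p (\<lambda>x. \<phi> m x - \<phi> n x) < \<epsilon>)}"

definition cauchy_rel ::
    "real \<Rightarrow> real \<Rightarrow> 'a::euclidean_space set \<Rightarrow> (nat \<Rightarrow> 'a \<Rightarrow> real) rel" where
  "cauchy_rel s p \<Omega> = {(\<phi>, \<psi>). \<phi> \<in> cauchy_tests s p \<Omega> \<and> \<psi> \<in> cauchy_tests s p \<Omega> \<and>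
     (\<lambda>n. gagliardo_norm s p (\<lambda>x. \<phi> n x - \<psi> n x)) \<longlonglongrightarrow> 0}"

definition D0_class ::
    "real \<Rightarrow> real \<Rightarrow> 'a::euclidean_space set \<Rightarrow> (nat \<Rightarrow> 'a \<Rightarrow> real) \<Rightarrow> (nat \<Rightarrow> 'a \<Rightarrow> real) set" where
  "D0_class s p \<Omega> \<phi> = cauchy_rel s p \<Omega> `` {\<phi>}"

definition D0 ::
    "real \<Rightarrow> real \<Rightarrow> 'a::euclidean_space set \<Rightarrow> (nat \<Rightarrow> 'a \<Rightarrow> real) set set" where
  "D0 s p \<Omega> = cauchy_tests s p \<Omega> // cauchy_rel s p \<Omega>"

definition D0_norm ::
    "real \<Rightarrow> real \<Rightarrow> (nat \<Rightarrow> 'a::euclidean_space \<Rightarrow> real) set \<Rightarrow> real" where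
  "D0_norm s p X = lim (\<lambda>n. gagliardo_norm s p ((SOME \<phi>. \<phi> \<in> X) n))"

text \<open>\<open>J\<close> is a compact linear operator from the completion to \<open>L\<^sup>1(\<Omega>)\<close> which extends the
  inclusion of the test functions. Elements of \<open>L\<^sup>1(\<Omega>)\<close> are handled through representatives,
  so equalities are almost everywhere in \<open>\<Omega>\<close>. A compact linear operator is bounded, so by density
  of the test functions \<open>J\<close> is determined up to null sets.\<close>

definition compact_embedding ::
    "real \<Rightarrow> real \<Rightarrow> 'a::euclidean_space set \<Rightarrow> ((nat \<Rightarrow> 'a \<Rightarrow> real) set \<Rightarrow> 'a \<Rightarrow> real) \<Rightarrow> bool" where
  "compact_embedding s p \<Omega> J \<longleftrightarrow>
     (\<forall>X\<in>D0 s p \<Omega>. set_integrable lebesgue \<Omega> (J X)) \<and>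
     (\<forall>a b. \<forall>\<phi>\<in>cauchy_tests s p \<Omega>. \<forall>\<psi>\<in>cauchy_tests s p \<Omega>. AE x in lebesgue. x \<in> \<Omega> \<longrightarrow>
        J (D0_class s p \<Omega> (\<lambda>n x. a * \<phi> n x + b * \<psi> n x)) x =
          a * J (D0_class s p \<Omega> \<phi>) x + b * J (D0_class s p \<Omega> \<psi>) x) \<and>
     (\<forall>f\<in>test_functions \<Omega>. AE x in lebesgue. x \<in> \<Omega> \<longrightarrow> J (D0_class s p \<Omega> (\<lambda>n. f)) x = f x) \<and>
     (\<forall>X. (\<forall>k. X k \<in> D0 s p \<Omega>) \<and> (\<exists>B. \<forall>k. D0_norm s p (X k) \<le> B) \<longrightarrow>
        (\<exists>r g. strict_mono (r :: nat \<Rightarrow> nat) \<and> set_integrable lebesgue \<Omega> g \<and>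
           (\<lambda>k. \<integral>\<^sup>+x\<in>\<Omega>. ennreal \<bar>J (X (r k)) x - g x\<bar> \<partial>lebesgue) \<longlonglongrightarrow> 0))"

text \<open>The elements of the completion as functions on the whole space, via \<open>J\<close> and extension
  by zero; all representatives are included.\<close>

definition D0_functions ::
    "real \<Rightarrow> real \<Rightarrow> 'a::euclidean_space set \<Rightarrow> ((nat \<Rightarrow> 'a \<Rightarrow> real) set \<Rightarrow> 'a \<Rightarrow> real) \<Rightarrow>
      ('a \<Rightarrow> real) set" where
  "D0_functions s p \<Omega> J = {u. (\<forall>x. x \<notin> \<Omega> \<longrightarrow> u x = 0) \<and>
     (\<exists>X\<in>D0 s p \<Omega>. AE x in lebesgue. x \<in> \<Omega> \<longrightarrow> u x = J X x)}"

definition torsion_functional ::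
    "real \<Rightarrow> real \<Rightarrow> 'a::euclidean_space set \<Rightarrow> ('a \<Rightarrow> real) \<Rightarrow> ereal" where
  "torsion_functional s p \<Omega> u =
     ereal (1 / p) * enn2ereal (gagliardo_energy s p u) - ereal (LINT x:\<Omega>|lebesgue. u x)"

definition torsion_function ::
    "real \<Rightarrow> real \<Rightarrow> 'a::euclidean_space set \<Rightarrow> ((nat \<Rightarrow> 'a \<Rightarrow> real) set \<Rightarrow> 'a \<Rightarrow> real) \<Rightarrow>
      ('a \<Rightarrow> real) \<Rightarrow> bool" where
  "torsion_function s p \<Omega> J w \<longleftrightarrow> w \<in> D0_functions s p \<Omega> J \<and>
     (\<forall>u\<in>D0_functions s p \<Omega> J. torsion_functional s p \<Omega> w \<le> torsion_functional s p \<Omega> u)"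

end

theory Submission
  imports Defs
begin

text \<open>
  Write \<open>E u\<close> for the Gagliardo energy, so that the torsion function \<open>w\<close> minimises \<open>E u / p - \<integral>u\<close>.
  The idea is to test minimality against \<open>S\<^sub>t = (|w|\<^sup>p + t |u|\<^sup>p)\<^sup>1\<^sup>/\<^sup>p\<close> with \<open>t \<ge> 0\<close>. At each point
  \<open>S\<^sub>t\<close> is the \<open>\<ell>\<^sup>p\<close> norm of the vector with components \<open>w\<close> and \<open>t\<^sup>1\<^sup>/\<^sup>p u\<close>, so the reverse triangle
  inequality gives \<open>E S\<^sub>t \<le> E w + t E u\<close>. The energy of \<open>w\<close> cancels in the comparison of \<open>w\<close> with
  \<open>S\<^sub>t\<close>, and what is left is \<open>\<integral>S\<^sub>t \<le> \<integral>w + (t / p) E u\<close> (\<open>torsion_minimality\<close>).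

  For \<open>t = 0\<close> this says that the integral of \<open>|w|\<close> is at most that of \<open>w\<close>, so \<open>w \<ge> 0\<close>. For \<open>t > 0\<close>
  convexity of \<open>x\<^sup>p\<close> gives \<open>S\<^sub>t - w \<ge> (t / p) |u|\<^sup>p / S\<^sub>t\<^sup>p\<^sup>-\<^sup>1\<close> (\<open>lp_increment_lower\<close>). Hence
  \<open>|u|\<^sup>p / S\<^sub>t\<^sup>p\<^sup>-\<^sup>1\<close> has integral at most \<open>E u\<close>, and Fatou as \<open>t\<close> tends to \<open>0\<close> gives the theorem.
  Positivity of \<open>w\<close> comes out rather than in: the limit integrand is \<open>\<infinity>\<close> where \<open>w = 0 \<noteq> u\<close>, so the
  inequality itself says that \<open>u\<close> vanishes almost everywhere on the zero set of \<open>w\<close>.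

  The completion makes it inconvenient to show that \<open>S\<^sub>t\<close> is an admissible competitor. It
  is replaced by the smooth function \<open>smooth_lp\<close> of two test functions, one close to \<open>w\<close> and one
  close to \<open>u\<close>, which is again a test function and obeys the same energy estimate. Two facts
  carry the passage to the limit. Test functions have finite energy
  (\<open>test_function_energy_finite\<close>), so the seminorm satisfies the triangle inequality on them. And every
  element of the completion, seen as a function through the compact embedding, is the limit
  of test functions both almost everywhere and in energy (\<open>D0_functions_approx\<close>).
\<close>

section \<open>Elementary inequalities\<close>

lemma powr_convex_combination:
  fixes a b l :: real
  assumes "1 \<le> p" "0 \<le> a" "0 \<le> b" "0 \<le> l" "l \<le> 1"
  shows "((1 - l) * a + l * b) powr p \<le> (1 - l) * a powr p + l * b powr p"
proof -
  have 0: "l powr p \<le> l" if "0 \<le> l" "l \<le> 1" for l :: real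
    using powr_mono'[of 1 p l] that assms(1) by simp
  consider "a = 0" | "b = 0" | "0 < a" "0 < b" using assms by linarith
  then show ?thesis
  proof cases
    case 1
    then show ?thesis using 0[of l] assms by (simp add: powr_mult mult_right_mono)
  next
    case 2
    then show ?thesis using 0[of "1 - l"] assms by (simp add: powr_mult mult_right_mono)
  next
    case 3
    then show ?thesis
      using convex_onD[OF powr_convex[OF assms(1)], of l a b] assms by simp
  qed
qed

text \<open>Convexity of \<open>x powr p\<close>, applied to the convex combination of \<open>a / A\<close> and \<open>b / B\<close> with
  weights \<open>A / (A + B)\<close> and \<open>B / (A + B)\<close>. When \<open>A\<close> and \<open>B\<close> are the norms of two vectors or two
  functions, summing or integrating this gives the triangle inequality for their sum; it is used
  in this way both for the \<open>\<ell>\<^sup>p\<close> norm on the plane and for the Gagliardo seminorm.\<close>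

lemma powr_sum_le_weighted:
  fixes a b A B :: real
  assumes "1 < p" "0 \<le> a" "0 \<le> b" "0 < A" "0 < B"
  shows "(a + b) powr p \<le> (A + B) powr p * ((A / (A + B)) * (a / A) powr p + (B / (A + B)) * (b / B) powr p)"
proof -
  let ?l = "B / (A + B)"
  have l: "0 \<le> ?l" "?l \<le> 1" "1 - ?l = A / (A + B)"
    using assms by (auto simp: field_simps)
  have "((1 - ?l) * (a / A) + ?l * (b / B)) = a / (A + B) + b / (A + B)"
    using assms unfolding l(3) by simp
  also have "\<dots> = (a + b) / (A + B)" by (simp add: add_divide_distrib)
  finally have "((1 - ?l) * (a / A) + ?l * (b / B)) = (a + b) / (A + B)" .
  then have "((a + b) / (A + B)) powr p \<le> (A / (A + B)) * (a / A) powr p + ?l * (b / B) powr p"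
    using powr_convex_combination[of p "a / A" "b / B" ?l] assms l by simp
  moreover have "(a + b) powr p = (A + B) powr p * ((a + b) / (A + B)) powr p"
    using assms by (simp flip: powr_mult)
  ultimately show ?thesis
    by (simp add: mult_left_mono)
qed

lemma lp_triangle:
  fixes a b c d :: real
  assumes p: "1 < p" and nn: "0 \<le> a" "0 \<le> b" "0 \<le> c" "0 \<le> d"
  shows "((a + c) powr p + (b + d) powr p) powr (1 / p)
    \<le> (a powr p + b powr p) powr (1 / p) + (c powr p + d powr p) powr (1 / p)"
proof -
  define A where "A = (a powr p + b powr p) powr (1 / p)"
  define B where "B = (c powr p + d powr p) powr (1 / p)"
  have Ap: "A powr p = a powr p + b powr p" and Bp: "B powr p = c powr p + d powr p"
    using p by (simp_all add: A_def B_def powr_powr)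
  consider "A = 0" | "B = 0" | "A > 0" "B > 0"
    unfolding A_def B_def by (metis powr_ge_zero less_eq_real_def)
  then show ?thesis
  proof cases
    case 1
    then have "a powr p + b powr p = 0" by (simp add: A_def)
    then have "a = 0" "b = 0" by (smt (verit) powr_ge_zero powr_eq_0_iff)+
    then show ?thesis by simp
  next
    case 2
    then have "c powr p + d powr p = 0" by (simp add: B_def)
    then have "c = 0" "d = 0" by (smt (verit) powr_ge_zero powr_eq_0_iff)+
    then show ?thesis by simp
  next
    case 3
    have "(a / A) powr p + (b / A) powr p = (a powr p + b powr p) / A powr p"
      using 3 nn by (simp add: powr_divide add_divide_distrib)
    then have a1: "(a / A) powr p + (b / A) powr p = 1" using 3 by (simp flip: Ap)
    have "(c / B) powr p + (d / B) powr p = (c powr p + d powr p) / B powr p"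
      using 3 nn by (simp add: powr_divide add_divide_distrib)
    then have b1: "(c / B) powr p + (d / B) powr p = 1" using 3 by (simp flip: Bp)
    have "(a + c) powr p + (b + d) powr p
      \<le> (A + B) powr p * ((A / (A + B)) * ((a / A) powr p + (b / A) powr p)
          + (B / (A + B)) * ((c / B) powr p + (d / B) powr p))"
      using powr_sum_le_weighted[OF p nn(1,3) 3] powr_sum_le_weighted[OF p nn(2,4) 3]
      by (simp add: algebra_simps)
    also have "\<dots> = (A + B) powr p"
      unfolding a1 b1 using 3 by (simp flip: add_divide_distrib)
    finally have "((a + c) powr p + (b + d) powr p) powr (1 / p) \<le> ((A + B) powr p) powr (1 / p)"
      using p by (intro powr_mono2) auto
    also have "\<dots> = A + B" using p 3 by (simp add: powr_powr)
    finally show ?thesis by (simp add: A_def B_def)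
  qed
qed

text \<open>A smooth regularisation of the weighted \<open>\<ell>\<^sup>p\<close> norm \<open>(\<bar>a\<bar> powr p + t * \<bar>b\<bar> powr p) powr (1 / p)\<close>. For
  \<open>e \<noteq> 0\<close> and \<open>t \<ge> 0\<close> every base of a power is positive, so substituting smooth functions for \<open>a\<close> and \<open>b\<close>
  yields a smooth function.\<close>

definition smooth_lp :: "real \<Rightarrow> real \<Rightarrow> real \<Rightarrow> real \<Rightarrow> real \<Rightarrow> real" where
  "smooth_lp p t e a b = ((a\<^sup>2 + e\<^sup>2) powr (p / 2) + t * (b\<^sup>2 + e\<^sup>2) powr (p / 2)) powr (1 / p)"

text \<open>\<open>smooth_lp\<close> is the \<open>\<ell>\<^sup>p\<close> norm of the vector \<open>(r a, c * r b)\<close>, where \<open>r x = sqrt (x\<^sup>2 + e\<^sup>2)\<close> is a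
  contraction and \<open>c powr p = t\<close>; the estimate is the reverse triangle inequality for that norm.
  Applied to difference quotients, it bounds the energy of the competitor by the sum of the
  energies of its two ingredients, with no constant lost.\<close>

lemma smooth_lp_contraction:
  assumes p: "1 < p" and t: "0 \<le> t"
  shows "\<bar>smooth_lp p t e a b - smooth_lp p t e a' b'\<bar> powr p \<le> \<bar>a - a'\<bar> powr p + t * \<bar>b - b'\<bar> powr p"
proof -
  define r where "r = (\<lambda>x. sqrt (x\<^sup>2 + e\<^sup>2))"
  define c where "c = t powr (1 / p)"
  have c: "c powr p = t" "c \<ge> 0" using p t by (simp_all add: c_def powr_powr)
  have r0: "r x \<ge> 0" for x by (simp add: r_def)
  have rp: "(x\<^sup>2 + e\<^sup>2) powr (p / 2) = r x powr p" for x
    unfolding r_def by (simp add: powr_half_sqrt[symmetric] powr_powr)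
  have r1: "\<bar>r x - r y\<bar> \<le> \<bar>x - y\<bar>" for x y
    using norm_triangle_ineq3[of "Complex x e" "Complex y e"]
    by (simp add: r_def cmod_def)
  define N where "N = (\<lambda>x y. (x powr p + y powr p) powr (1 / p))"
  have S: "smooth_lp p t e x y = N (r x) (c * r y)" for x y
    using c r0 by (simp add: smooth_lp_def N_def rp powr_mult)
  have mono: "N x y \<le> N x' y'" if "0 \<le> x" "x \<le> x'" "0 \<le> y" "y \<le> y'" for x y x' y'
    unfolding N_def using that p by (intro powr_mono2 add_mono) auto
  have *: "N (r x) (c * r y) - N (r x') (c * r y') \<le> N \<bar>x - x'\<bar> (c * \<bar>y - y'\<bar>)" for x y x' y'
  proof -
    have "N (r x) (c * r y) \<le> N (r x' + \<bar>x - x'\<bar>) (c * r y' + c * \<bar>y - y'\<bar>)"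
    proof (intro mono)
      show "r x \<le> r x' + \<bar>x - x'\<bar>" using r1[of x x'] by linarith
      have "r y \<le> r y' + \<bar>y - y'\<bar>" using r1[of y y'] by linarith
      then have "c * r y \<le> c * (r y' + \<bar>y - y'\<bar>)" using c by (intro mult_left_mono)
      then show "c * r y \<le> c * r y' + c * \<bar>y - y'\<bar>" by (simp add: algebra_simps)
    qed (use r0 c in auto)
    also have "\<dots> \<le> N (r x') (c * r y') + N \<bar>x - x'\<bar> (c * \<bar>y - y'\<bar>)"
      unfolding N_def using p r0 c by (intro lp_triangle) auto
    finally show ?thesis by simp
  qed
  have "\<bar>smooth_lp p t e a b - smooth_lp p t e a' b'\<bar> \<le> N \<bar>a - a'\<bar> (c * \<bar>b - b'\<bar>)"
    unfolding S using *[of a b a' b'] *[of a' b' a b] by (simp add: abs_minus_commute)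
  then have "\<bar>smooth_lp p t e a b - smooth_lp p t e a' b'\<bar> powr p \<le> N \<bar>a - a'\<bar> (c * \<bar>b - b'\<bar>) powr p"
    using p by (intro powr_mono2) auto
  also have "\<dots> = \<bar>a - a'\<bar> powr p + t * \<bar>b - b'\<bar> powr p"
    using p c t by (simp add: N_def powr_powr powr_mult)
  finally show ?thesis .
qed

lemma smooth_lp_minimal:
  assumes "1 < p" "0 \<le> t"
  shows "smooth_lp p t e 0 0 \<le> smooth_lp p t e a b"
  unfolding smooth_lp_def using assms
  by (intro powr_mono2 add_mono mult_left_mono) auto

lemma smooth_lp_tendsto:
  assumes p: "1 < p" and t: "0 \<le> t"
    and e: "e \<longlonglongrightarrow> 0" and f: "f \<longlonglongrightarrow> a" and g: "g \<longlonglongrightarrow> b"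
  shows "(\<lambda>n. smooth_lp p t (e n) (f n) (g n)) \<longlonglongrightarrow> (\<bar>a\<bar> powr p + t * \<bar>b\<bar> powr p) powr (1 / p)"
proof -
  have sq: "(x\<^sup>2) powr (p / 2) = \<bar>x\<bar> powr p" for x :: real
    using powr_powr[of "x\<^sup>2" "1 / 2" p] by (simp add: powr_half_sqrt)
  have "(\<lambda>n. smooth_lp p t (e n) (f n) (g n)) \<longlonglongrightarrow>
     ((a\<^sup>2 + 0\<^sup>2) powr (p / 2) + t * (b\<^sup>2 + 0\<^sup>2) powr (p / 2)) powr (1 / p)"
    unfolding smooth_lp_def using p t
    by (intro tendsto_powr2 tendsto_add tendsto_mult tendsto_const tendsto_power e f g) auto
  then show ?thesis by (simp add: sq)
qed

lemma powr_above_tangent: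
  fixes a b :: real
  assumes p: "1 < p" and nn: "0 \<le> a" "0 < b"
  shows "b powr p - a powr p \<le> p * b powr (p - 1) * (b - a)"
proof -
  have "p * b powr (p - 1) * (a - b) \<le> a powr p - b powr p"
  proof (cases "a = 0")
    case True
    have "b powr (p - 1) * b = b powr p" using powr_mult_base[of b "p - 1"] nn by (simp add: mult.commute)
    then have e: "p * b powr (p - 1) * (a - b) = - (p * b powr p)" using True by (simp add: mult.assoc)
    have "b powr p \<le> p * b powr p" using p mult_right_mono[of 1 p "b powr p"] by simp
    then show ?thesis unfolding e using True p by simp
  next
    case False
    show ?thesis
    proof (rule convex_on_imp_above_tangent[where A = "{0<..}"])
      show "convex_on {0<..} (\<lambda>x. x powr p)" using p by (intro powr_convex) simp
      show "((\<lambda>x. x powr p) has_field_derivative p * b powr (p - 1)) (at b within {0<..})"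
        using nn by (auto intro!: derivative_eq_intros)
      show "b \<in> interior {0<..}" using nn by (simp add: interior_open)
    qed (use nn False in auto)
  qed
  then show ?thesis by (simp add: algebra_simps)
qed

text \<open>The tangent to \<open>x powr p\<close> is taken at the larger point, the value \<open>S\<close> of the norm. This replaces
  the derivative at \<open>t = 0\<close> of the norm by a lower bound valid for every \<open>t\<close>, whose denominator stays
  positive even when \<open>a = 0\<close>.\<close>

lemma lp_increment_lower:
  fixes a b :: real
  assumes p: "1 < p" and t: "0 < t" and a: "0 \<le> a"
  shows "t / p * (\<bar>b\<bar> powr p / (a powr p + t * \<bar>b\<bar> powr p) powr ((p - 1) / p))
    \<le> (a powr p + t * \<bar>b\<bar> powr p) powr (1 / p) - a"
proof (cases "b = 0")
  case True
  then show ?thesis using p a by (simp add: powr_powr)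
next
  case False
  define S where "S = (a powr p + t * \<bar>b\<bar> powr p) powr (1 / p)"
  have pos: "a powr p + t * \<bar>b\<bar> powr p > 0" using False t by (simp add: add_nonneg_pos)
  have S0: "S > 0" using pos by (simp add: S_def)
  have Sp: "S powr p = a powr p + t * \<bar>b\<bar> powr p" using pos p by (simp add: S_def powr_powr)
  have Sp1: "S powr (p - 1) = (a powr p + t * \<bar>b\<bar> powr p) powr ((p - 1) / p)"
    using p by (simp add: S_def powr_powr)
  have "t * \<bar>b\<bar> powr p \<le> p * S powr (p - 1) * (S - a)"
    using powr_above_tangent[OF p a S0] Sp by simp
  then have "t / p * (\<bar>b\<bar> powr p / S powr (p - 1)) \<le> S - a"
    using S0 p by (simp add: field_simps)
  then show ?thesis unfolding Sp1 by (simp add: S_def)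
qed

section \<open>Calculus of smooth functions\<close>

lemma Ck_Suc_imp: "Ck (Suc k) f \<Longrightarrow> Ck k f"
proof (induction k arbitrary: f)
  case 0
  then show ?case
    by (auto intro!: continuous_at_imp_continuous_on differentiable_imp_continuous_within)
next
  case (Suc k)
  then show ?case by (metis Ck.simps(2))
qed

lemma Ck_const: "Ck k (\<lambda>x. c)"
  by (induction k arbitrary: c) auto

lemma Ck_add: "Ck k f \<Longrightarrow> Ck k g \<Longrightarrow> Ck k (\<lambda>x. f x + g x)"
proof (induction k arbitrary: f g)
  case 0
  then show ?case by (auto intro: continuous_on_add continuous_on_mult)
next
  case (Suc k)
  have "frechet_derivative (\<lambda>x. f x + g x) (at x) v
      = frechet_derivative f (at x) v + frechet_derivative g (at x) v" for x v
  proof -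
    have "((\<lambda>x. f x + g x) has_derivative
       (\<lambda>v. frechet_derivative f (at x) v + frechet_derivative g (at x) v)) (at x)"
      using Suc.prems by (intro has_derivative_add) (auto simp: frechet_derivative_works[symmetric])
    from frechet_derivative_at[OF this] show ?thesis by metis
  qed
  then show ?case using Suc by auto
qed

lemma Ck_mult: "Ck k f \<Longrightarrow> Ck k g \<Longrightarrow> Ck k (\<lambda>x. f x * g x)"
proof (induction k arbitrary: f g)
  case 0
  then show ?case by (auto intro: continuous_on_add continuous_on_mult)
next
  case (Suc k)
  have "frechet_derivative (\<lambda>x. f x * g x) (at x) v
      = f x * frechet_derivative g (at x) v + frechet_derivative f (at x) v * g x" for x v
  proof -
    have "((\<lambda>x. f x * g x) has_derivative
       (\<lambda>v. f x * frechet_derivative g (at x) v + frechet_derivative f (at x) v * g x)) (at x)"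
      using Suc.prems by (intro has_derivative_mult) (auto simp: frechet_derivative_works[symmetric])
    from frechet_derivative_at[OF this] show ?thesis by metis
  qed
  moreover have "Ck k f" "Ck k g" using Suc.prems Ck_Suc_imp by blast+
  ultimately show ?case using Suc.prems Suc.IH Ck_add by (auto intro!: Ck_add Suc.IH)
qed

text \<open>The derivative of \<open>f powr a\<close> contains \<open>f powr (a - 1)\<close>, so the induction on \<open>k\<close> has to run over all
  exponents at once.\<close>

lemma Ck_powr:
  fixes f :: "'a::euclidean_space \<Rightarrow> real"
  shows "Ck k f \<Longrightarrow> (\<And>x. f x > 0) \<Longrightarrow> Ck k (\<lambda>x. f x powr a)"
proof (induction k arbitrary: a)
  case 0
  then show ?case by (auto intro!: continuous_on_powr continuous_on_const) (metis less_irrefl)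
next
  case (Suc k)
  have d: "((\<lambda>x. f x powr a) has_derivative
       (\<lambda>v. a * f x powr (a - 1) * frechet_derivative f (at x) v)) (at x)" for x
  proof -
    have "((\<lambda>y. y powr a) has_derivative (\<lambda>h. a * f x powr (a - 1) * h)) (at (f x))"
      using has_real_derivative_powr[OF Suc.prems(2), of a x]
      unfolding has_field_derivative_def by simp
    moreover have "(f has_derivative frechet_derivative f (at x)) (at x)"
      using Suc.prems by (auto simp: frechet_derivative_works[symmetric])
    ultimately show ?thesis
      using diff_chain_at[of f _ x "\<lambda>y. y powr a"] by (fastforce simp: o_def)
  qed
  have "frechet_derivative (\<lambda>x. f x powr a) (at x) v
      = a * f x powr (a - 1) * frechet_derivative f (at x) v" for x v
    using frechet_derivative_at[OF d] by metis
  moreover have "(\<lambda>x. f x powr a) differentiable (at x)" for x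
    using d differentiable_def by blast
  moreover have "Ck k f" using Suc.prems Ck_Suc_imp by blast
  ultimately show ?case using Suc by (auto intro!: Ck_mult Ck_const)
qed

text \<open>The support of a function that vanishes wherever two test functions both vanish is a closed
  subset of the union of their supports.\<close>

lemma test_functionI:
  assumes "\<And>k. Ck k f" and "f' \<in> test_functions \<Omega>" "f'' \<in> test_functions \<Omega>"
    and "\<And>x. f' x = 0 \<Longrightarrow> f'' x = 0 \<Longrightarrow> f x = 0"
  shows "f \<in> test_functions \<Omega>"
proof -
  let ?K = "closure {x. f' x \<noteq> 0} \<union> closure {x. f'' x \<noteq> 0}"
  have K: "compact ?K" "?K \<subseteq> \<Omega>" using assms unfolding test_functions_def by auto
  have "{x. f x \<noteq> 0} \<subseteq> ?K"
    using assms(4) closure_subset[of "{x. f' x \<noteq> 0}"] closure_subset[of "{x. f'' x \<noteq> 0}"] by blast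
  then have "closure {x. f x \<noteq> 0} \<subseteq> ?K"
    using K(1) by (intro closure_minimal) (auto intro: compact_imp_closed)
  then have "closure {x. f x \<noteq> 0} \<subseteq> \<Omega>" "compact (closure {x. f x \<noteq> 0})"
    using K compact_Int_closed[OF K(1), of "closure {x. f x \<noteq> 0}"]
    by (auto simp: Int_absorb1)
  then show ?thesis using assms(1) by (simp add: test_functions_def)
qed

lemma test_functions_linear:
  assumes "f \<in> test_functions \<Omega>" "g \<in> test_functions \<Omega>"
  shows "(\<lambda>x. a * f x + b * g x) \<in> test_functions \<Omega>"
  using assms by (intro test_functionI[OF _ assms] Ck_add Ck_mult Ck_const) (auto simp: test_functions_def)

text \<open>Subtracting the value at \<open>(0, 0)\<close> makes the regularised norm vanish off the two supports.\<close>

lemma test_functions_smooth_lp: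
  assumes f: "f \<in> test_functions \<Omega>" and g: "g \<in> test_functions \<Omega>" and e: "e \<noteq> 0" and t: "0 \<le> t"
  shows "(\<lambda>x. smooth_lp p t e (f x) (g x) - smooth_lp p t e 0 0) \<in> test_functions \<Omega>"
proof (rule test_functionI[OF _ f g])
  fix k
  have Ck: "Ck k f" "Ck k g" using f g by (auto simp: test_functions_def)
  have pos: "x\<^sup>2 + e\<^sup>2 > 0" for x using e by (simp add: add_nonneg_pos)
  have "Ck k (\<lambda>x. smooth_lp p t e (f x) (g x) + - smooth_lp p t e 0 0)"
    unfolding smooth_lp_def power2_eq_square
    by (intro Ck_add Ck_powr Ck_mult Ck_const Ck)
      (use pos t in \<open>auto simp: power2_eq_square[symmetric] intro!: add_pos_nonneg\<close>)
  then show "Ck k (\<lambda>x. smooth_lp p t e (f x) (g x) - smooth_lp p t e 0 0)" by simp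
qed simp

lemma test_function_continuous: "f \<in> test_functions \<Omega> \<Longrightarrow> continuous_on UNIV f"
  unfolding test_functions_def using Ck.simps(1) by blast

lemma test_function_borel: "f \<in> test_functions \<Omega> \<Longrightarrow> f \<in> borel_measurable borel"
  by (intro borel_measurable_continuous_onI test_function_continuous)

lemma test_function_outside: "f \<in> test_functions \<Omega> \<Longrightarrow> x \<notin> \<Omega> \<Longrightarrow> f x = 0"
  unfolding test_functions_def using closure_subset[of "{x. f x \<noteq> 0}"] by auto

lemma bounded_if_compact_support:
  fixes f :: "'a::euclidean_space \<Rightarrow> real"
  assumes "continuous_on UNIV f" "compact K" "\<And>x. x \<notin> K \<Longrightarrow> f x = 0"
  obtains B where "0 \<le> B" "\<And>x. \<bar>f x\<bar> \<le> B"
proof -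
  have "bounded (f ` K)"
    using assms by (meson compact_continuous_image compact_imp_bounded continuous_on_subset top_greatest)
  then obtain B where B: "\<And>x. x \<in> K \<Longrightarrow> \<bar>f x\<bar> \<le> B" by (auto simp: bounded_iff)
  have "\<bar>f x\<bar> \<le> \<bar>B\<bar>" for x using B[of x] assms(3)[of x] by (cases "x \<in> K") auto
  then show ?thesis using that[of "\<bar>B\<bar>"] by auto
qed

text \<open>Each directional derivative along a basis vector is continuous with compact support, hence
  bounded, and these finitely many bounds control the operator norm of the derivative.\<close>

lemma test_function_lipschitz:
  fixes f :: "'a::euclidean_space \<Rightarrow> real"
  assumes f: "f \<in> test_functions \<Omega>"
  obtains L where "0 \<le> L" "\<And>x y. \<bar>f x - f y\<bar> \<le> L * norm (x - y)"
proof -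
  let ?K = "closure {x. f x \<noteq> 0}"
  let ?D = "\<lambda>x. frechet_derivative f (at x)"
  have K: "compact ?K" and C1: "Ck (Suc 0) f" using f by (auto simp: test_functions_def)
  have D: "(f has_derivative ?D x) (at x)" for x
    using C1 by (simp add: frechet_derivative_works[symmetric])
  have cont: "continuous_on UNIV (\<lambda>x. ?D x v)" for v using C1 by simp
  have zero: "?D x v = 0" if "x \<notin> ?K" for x v
  proof -
    have "((\<lambda>_. 0) has_derivative (\<lambda>_. 0)) (at x)" by simp
    moreover have "open (- ?K)" "x \<in> - ?K" using that by (auto simp: closed_def[symmetric])
    moreover have "0 = f y" if "y \<in> - ?K" for y using that closure_subset[of "{x. f x \<noteq> 0}"] by auto
    ultimately have "(f has_derivative (\<lambda>_. 0)) (at x)"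
      by (rule has_derivative_transform_within_open)
    from frechet_derivative_at[OF this] show ?thesis by metis
  qed
  have "\<exists>B. 0 \<le> B \<and> (\<forall>x. \<bar>?D x v\<bar> \<le> B)" for v
    using bounded_if_compact_support[OF cont K zero] by metis
  then obtain B where B: "\<And>v. 0 \<le> B v" "\<And>v x. \<bar>?D x v\<bar> \<le> B v" by metis
  let ?L = "\<Sum>b\<in>Basis. B b"
  have "onorm (?D x) \<le> ?L" for x
  proof (rule onorm_bound)
    fix v :: 'a
    have lin: "linear (?D x)" using D has_derivative_linear by blast
    have "?D x v = ?D x (\<Sum>b\<in>Basis. (v \<bullet> b) *\<^sub>R b)" by (simp add: euclidean_representation)
    also have "\<dots> = (\<Sum>b\<in>Basis. (v \<bullet> b) * ?D x b)"
      by (simp add: linear_sum[OF lin] linear_scale[OF lin])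
    finally have "norm (?D x v) \<le> (\<Sum>b\<in>Basis. \<bar>(v \<bullet> b) * ?D x b\<bar>)" by simp
    also have "\<dots> \<le> (\<Sum>b\<in>Basis. norm v * B b)"
      unfolding abs_mult by (intro sum_mono mult_mono B Basis_le_norm) auto
    finally show "norm (?D x v) \<le> ?L * norm v" by (simp add: sum_distrib_left mult.commute)
  qed (use B in \<open>auto intro: sum_nonneg\<close>)
  then have "norm (f x - f y) \<le> ?L * norm (x - y)" for x y
    using differentiable_bound[of UNIV f ?D ?L x y] D by auto
  then show ?thesis using that[of ?L] B by (auto intro: sum_nonneg)
qed

section \<open>The energy of a test function\<close>

text \<open>The ball of radius \<open>r j\<close> has volume proportional to \<open>r j ^ DIM('a)\<close>, so the integral of the series is
  a geometric series.\<close>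

lemma nn_integral_ball_series_finite:
  fixes c r :: "nat \<Rightarrow> real"
  assumes nn: "\<And>j. 0 \<le> c j" "\<And>j. 0 \<le> r j"
    and eq: "\<And>j. c j * r j ^ DIM('a) = C * q ^ j" and q: "0 \<le> q" "q < 1"
  shows "(\<integral>\<^sup>+z. (\<Sum>j. ennreal (c j) * indicator (ball (0::'a::euclidean_space) (r j)) z) \<partial>lborel) < \<infinity>"
proof -
  let ?V = "unit_ball_vol (real DIM('a))"
  have [measurable]: "ball (0::'a) d \<in> sets borel" for d by simp
  have e: "(\<integral>\<^sup>+z. ennreal (c j) * indicator (ball (0::'a) (r j)) z \<partial>lborel)
      = ennreal (c j) * emeasure lborel (ball (0::'a) (r j))" for j
    by (rule nn_integral_cmult_indicator) simp
  have "(\<integral>\<^sup>+z. (\<Sum>j. ennreal (c j) * indicator (ball (0::'a) (r j)) z) \<partial>lborel)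
      = (\<Sum>j. \<integral>\<^sup>+z. ennreal (c j) * indicator (ball (0::'a) (r j)) z \<partial>lborel)"
    by (rule nn_integral_suminf) measurable
  also have "\<dots> = (\<Sum>j. ennreal (c j) * emeasure lborel (ball (0::'a) (r j)))"
    by (simp only: e)
  also have "\<dots> = (\<Sum>j. ennreal (?V * (C * q ^ j)))"
    using nn by (simp add: emeasure_ball flip: eq ennreal_mult) (simp add: mult_ac)
  also have "\<dots> < \<infinity>"
  proof -
    have "0 \<le> ?V * (C * q ^ j)" for j
      using nn by (simp flip: eq)
    moreover have "summable (\<lambda>j. ?V * (C * q ^ j))"
      using q by (intro summable_mult summable_geometric) simp
    ultimately have "(\<Sum>j. ennreal (?V * (C * q ^ j))) = ennreal (\<Sum>j. ?V * (C * q ^ j))"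
      by (intro suminf_ennreal2)
    then show ?thesis by simp
  qed
  finally show ?thesis .
qed

lemma dyadic_bounds:
  fixes x :: real
  assumes "0 < x"
  obtains (small) j :: nat where "2 powr (- real j - 1) \<le> x" "x < 2 powr (- real j)"
    | (large) j :: nat where "2 powr real j \<le> x" "x < 2 powr (real j + 1)"
proof -
  define k where "k = \<lfloor>log 2 x\<rfloor>"
  have "2 powr real_of_int k \<le> 2 powr log 2 x" "2 powr log 2 x < 2 powr (real_of_int k + 1)"
    by (simp_all add: k_def)
  then have k: "2 powr real_of_int k \<le> x" "x < 2 powr (real_of_int k + 1)"
    using assms by simp_all
  show ?thesis
  proof (cases "0 \<le> k")
    case True
    then show ?thesis using large[of "nat k"] k by simp
  next
    case False
    then have "real (nat (- k - 1)) = - real_of_int k - 1" by simp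
    then show ?thesis using small[of "nat (- k - 1)"] k by (simp add: add.commute)
  qed
qed

text \<open>On the dyadic annulus \<open>2 powr k \<le> norm z < 2 powr (k + 1)\<close> the integrand is comparable to a constant.
  Bounding that annulus by a ball, the annuli inside the unit ball contribute a geometric series
  of ratio \<open>2 powr (- (p * (1 - s)))\<close>, those outside one of ratio \<open>2 powr (- (s * p))\<close>. This is where both
  \<open>s < 1\<close> and \<open>0 < s\<close> enter.\<close>

lemma kernel_integral_finite:
  fixes s p :: real
  assumes p: "1 < p" and s: "0 < s" "s < 1"
  shows "(\<integral>\<^sup>+z. ennreal (min 1 (norm z) powr p / norm z powr (real DIM('a) + s * p))
    \<partial>(lborel :: 'a::euclidean_space measure)) < \<infinity>"
proof -
  have [measurable]: "ball (0::'a) d \<in> sets borel" for d by simp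
  define N where "N = real DIM('a)"
  define M where "M = N + s * p"
  have M0: "M > 0" using p s by (simp add: M_def N_def add_pos_pos)
  define c1 where "c1 = (\<lambda>j::nat. 2 powr (- real j * p) * 2 powr ((real j + 1) * M))"
  define r1 where "r1 = (\<lambda>j::nat. 2 powr (- real j) :: real)"
  define c2 where "c2 = (\<lambda>j::nat. 2 powr (- real j * M))"
  define r2 where "r2 = (\<lambda>j::nat. 2 powr (real j + 1) :: real)"
  let ?S1 = "\<lambda>z. (\<Sum>j. ennreal (c1 j) * indicator (ball (0::'a) (r1 j)) z)"
  let ?S2 = "\<lambda>z. (\<Sum>j. ennreal (c2 j) * indicator (ball (0::'a) (r2 j)) z)"
  \<comment> \<open>Each point lies in one annulus, and a single term of the series is at most its sum.\<close>
  have one: "a \<le> (\<Sum>j. ennreal (c j) * indicator (ball (0::'a) (r j)) z)"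
    if "a \<le> ennreal (c j)" "norm z < r j" for a c r j and z :: 'a
  proof -
    have "a \<le> (\<Sum>j\<in>{j}. ennreal (c j) * indicator (ball (0::'a) (r j)) z)"
      using that by simp
    also have "\<dots> \<le> (\<Sum>j. ennreal (c j) * indicator (ball (0::'a) (r j)) z)"
      by (intro sum_le_suminf) auto
    finally show ?thesis .
  qed
  have bound: "ennreal (min 1 (norm z) powr p / norm z powr M) \<le> ?S1 z + ?S2 z" for z
  proof (cases "z = 0")
    case True
    then show ?thesis using p by simp
  next
    case False
    then have "0 < norm z" by simp
    then show ?thesis
    proof (cases rule: dyadic_bounds)
      case (small j)
      have "min 1 (norm z) powr p \<le> (2 powr (- real j)) powr p"
        using small p by (intro powr_mono2) auto
      moreover have "(2 powr (- real j - 1)) powr M \<le> norm z powr M"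
        using small M0 by (intro powr_mono2) auto
      ultimately have "min 1 (norm z) powr p / norm z powr M
          \<le> (2 powr (- real j)) powr p / (2 powr (- real j - 1)) powr M"
        by (intro frac_le) auto
      also have "\<dots> = c1 j"
        by (simp add: c1_def powr_powr divide_powr_uminus algebra_simps)
      finally have "ennreal (min 1 (norm z) powr p / norm z powr M) \<le> ?S1 z"
        using small by (intro one[of _ c1 j]) (auto simp: r1_def ennreal_leI)
      then show ?thesis by (simp add: add_increasing2)
    next
      case (large j)
      have "(2 powr real j) powr M \<le> norm z powr M"
        using large M0 by (intro powr_mono2) auto
      moreover have "min 1 (norm z) powr p \<le> 1 powr p"
        using p by (intro powr_mono2) auto
      ultimately have "min 1 (norm z) powr p / norm z powr M \<le> 1 / (2 powr real j) powr M"
        by (intro frac_le) auto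
      also have "\<dots> = c2 j"
        by (simp add: c2_def powr_powr divide_powr_uminus)
      finally have "ennreal (min 1 (norm z) powr p / norm z powr M) \<le> ?S2 z"
        using large by (intro one[of _ c2 j]) (auto simp: r2_def ennreal_leI)
      then show ?thesis by (simp add: add_increasing)
    qed
  qed
  have q: "2 powr (- a) < (1::real)" if "0 < a" for a :: real
    using that powr_less_mono[of "- a" 0 2] by simp
  have pw: "(2 powr a) ^ n = (2 powr (a * real n) :: real)" for a :: real and n
    by (simp add: powr_powr flip: powr_realpow)
  have "(\<integral>\<^sup>+z. ?S1 z \<partial>lborel) < \<infinity>"
  proof (rule nn_integral_ball_series_finite)
    show "c1 j * r1 j ^ DIM('a) = 2 powr M * (2 powr (- (p * (1 - s)))) ^ j" for j
      unfolding c1_def r1_def pw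
      by (simp add: M_def N_def algebra_simps flip: powr_add)
    show "2 powr (- (p * (1 - s))) < (1::real)" using p s by (intro q) simp
  qed (auto simp: c1_def r1_def)
  moreover have "(\<integral>\<^sup>+z. ?S2 z \<partial>lborel) < \<infinity>"
  proof (rule nn_integral_ball_series_finite)
    show "c2 j * r2 j ^ DIM('a) = 2 powr N * (2 powr (- (s * p))) ^ j" for j
      unfolding c2_def r2_def pw
      by (simp add: M_def N_def algebra_simps flip: powr_add)
    show "2 powr (- (s * p)) < (1::real)" using p s by (intro q) simp
  qed (auto simp: c2_def r2_def)
  ultimately have "(\<integral>\<^sup>+z. ?S1 z + ?S2 z \<partial>lborel) < \<infinity>"
    by (simp add: nn_integral_add)
  moreover have "(\<integral>\<^sup>+z. ennreal (min 1 (norm z) powr p / norm z powr M) \<partial>(lborel :: 'a measure))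
      \<le> (\<integral>\<^sup>+z. ?S1 z + ?S2 z \<partial>lborel)"
    by (intro nn_integral_mono bound)
  ultimately show ?thesis by (simp add: M_def N_def)
qed

definition gagliardo_integrand ::
    "real \<Rightarrow> real \<Rightarrow> ('a::euclidean_space \<Rightarrow> real) \<Rightarrow> 'a \<times> 'a \<Rightarrow> ennreal" where
  "gagliardo_integrand s p u z = ennreal (\<bar>u (fst z) - u (snd z)\<bar> powr p
     / norm (fst z - snd z) powr (real DIM('a) + s * p))"

lemma gagliardo_energy_lborel:
  "gagliardo_energy s p u = (\<integral>\<^sup>+z. gagliardo_integrand s p u z \<partial>(lborel \<Otimes>\<^sub>M lborel))"
  unfolding gagliardo_energy_def nn_integral_completion lborel_prod gagliardo_integrand_def case_prod_beta ..

lemma gagliardo_integrand_measurable [measurable]: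
  fixes u :: "'a::euclidean_space \<Rightarrow> real"
  assumes [measurable]: "u \<in> borel_measurable borel"
  shows "gagliardo_integrand s p u \<in> borel_measurable (lborel \<Otimes>\<^sub>M lborel)"
  unfolding gagliardo_integrand_def by measurable

lemma nn_integral_lborel_shift_diff:
  fixes g :: "'a::euclidean_space \<Rightarrow> ennreal"
  assumes [measurable]: "g \<in> borel_measurable borel"
  shows "(\<integral>\<^sup>+y. g (y - x) \<partial>lborel) = (\<integral>\<^sup>+y. g y \<partial>lborel)"
proof -
  have "(\<integral>\<^sup>+y. g y \<partial>lborel) = (\<integral>\<^sup>+y. g y \<partial>distr lborel borel ((+) (- x)))"
    by (simp add: lborel_distr_plus)
  also have "\<dots> = (\<integral>\<^sup>+y. g (- x + y) \<partial>lborel)"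
    by (subst nn_integral_distr) auto
  finally show ?thesis by simp
qed

text \<open>A test function satisfies \<open>\<bar>f x - f y\<bar> \<le> D * min 1 (norm (x - y))\<close>, and the difference vanishes unless \<open>x\<close> or
  \<open>y\<close> lies in the support \<open>K\<close>. Integrating first in the other variable reduces the energy to
  the volume of \<open>K\<close> times the integral of the kernel. Finiteness matters beyond its own sake:
  \<open>gagliardo_norm\<close> sends an infinite energy to \<open>0\<close>, so it obeys the triangle inequality only among functions of
  finite energy.\<close>

lemma test_function_energy_finite:
  fixes f :: "'a::euclidean_space \<Rightarrow> real"
  assumes p: "1 < p" and s: "0 < s" "s < 1" and f: "f \<in> test_functions \<Omega>"
  shows "gagliardo_energy s p f < \<infinity>"
proof -
  define K where "K = closure {x. f x \<noteq> 0}"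
  have K: "compact K" and f0: "\<And>x. x \<notin> K \<Longrightarrow> f x = 0"
    using f closure_subset[of "{x. f x \<noteq> 0}"] by (auto simp: test_functions_def K_def)
  have Kb [measurable]: "K \<in> sets borel" by (simp add: K_def)
  obtain B where B: "0 \<le> B" "\<And>x. \<bar>f x\<bar> \<le> B"
    using bounded_if_compact_support[OF test_function_continuous[OF f] K f0] by metis
  obtain L where L: "0 \<le> L" "\<And>x y. \<bar>f x - f y\<bar> \<le> L * norm (x - y)"
    using test_function_lipschitz[OF f] by metis
  define D where "D = L + 2 * B"
  define g where "g = (\<lambda>z::'a. ennreal (min 1 (norm z) powr p / norm z powr (real DIM('a) + s * p)))"
  have g [measurable]: "g \<in> borel_measurable borel" unfolding g_def by measurable
  have g_sym: "g (x - y) = g (y - x)" for x y by (simp add: g_def norm_minus_commute)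
  have D: "\<bar>f x - f y\<bar> \<le> D * min 1 (norm (x - y))" for x y
  proof (cases "norm (x - y) \<le> 1")
    case True
    then show ?thesis using L(2)[of x y] B(1)
      by (simp add: D_def min_def algebra_simps) (smt (verit) mult_nonneg_nonneg norm_ge_zero)
  next
    case False
    have "\<bar>f x - f y\<bar> \<le> 2 * B" using B(2)[of x] B(2)[of y] by linarith
    then show ?thesis using False L(1) by (simp add: D_def)
  qed
  have D0: "0 \<le> D" using B L by (simp add: D_def)
  let ?c = "ennreal (D powr p)"
  have bound: "gagliardo_integrand s p f z
      \<le> ?c * (g (snd z - fst z) * indicator K (fst z)) + ?c * (g (fst z - snd z) * indicator K (snd z))" for z
  proof (cases "fst z \<in> K \<or> snd z \<in> K")
    case True
    have "\<bar>f (fst z) - f (snd z)\<bar> powr p \<le> (D * min 1 (norm (fst z - snd z))) powr p"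
      using p by (intro powr_mono2 D) auto
    also have "\<dots> = D powr p * min 1 (norm (fst z - snd z)) powr p"
      using D0 by (simp add: powr_mult)
    finally have "gagliardo_integrand s p f z \<le> ?c * g (fst z - snd z)"
      unfolding gagliardo_integrand_def g_def
      by (subst ennreal_mult[symmetric]) (auto intro!: ennreal_leI simp: divide_right_mono)
    with True show ?thesis
      by (auto simp: indicator_def g_sym[of "snd z"] elim!: order_trans intro: add_increasing add_increasing2)
  next
    case False
    then have "f (fst z) = 0" "f (snd z) = 0" using f0 by blast+
    then show ?thesis using p by (simp add: gagliardo_integrand_def)
  qed
  have Kfin: "emeasure lborel K < \<infinity>" using K by (intro emeasure_bounded_finite compact_imp_bounded)
  have gfin: "(\<integral>\<^sup>+z. g z \<partial>lborel) < \<infinity>" unfolding g_def using kernel_integral_finite[OF p s] .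
  have m [measurable]:
    "(\<lambda>z. g (snd z - fst z) * indicator K (fst z)) \<in> borel_measurable (lborel \<Otimes>\<^sub>M lborel)"
    "(\<lambda>z. g (fst z - snd z) * indicator K (snd z)) \<in> borel_measurable (lborel \<Otimes>\<^sub>M lborel)"
    by measurable
  have 1: "(\<integral>\<^sup>+z. g (snd z - fst z) * indicator K (fst z) \<partial>(lborel \<Otimes>\<^sub>M lborel))
      = (\<integral>\<^sup>+z. g z \<partial>lborel) * emeasure lborel K"
  proof -
    have "(\<integral>\<^sup>+z. g (snd z - fst z) * indicator K (fst z) \<partial>(lborel \<Otimes>\<^sub>M lborel))
      = (\<integral>\<^sup>+x. \<integral>\<^sup>+y. g (y - x) * indicator K x \<partial>lborel \<partial>lborel)"
      using lborel.nn_integral_fst[OF m(1)] by simp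
    also have "\<dots> = (\<integral>\<^sup>+x. (\<integral>\<^sup>+z. g z \<partial>lborel) * indicator K x \<partial>lborel)"
      by (simp add: nn_integral_multc nn_integral_lborel_shift_diff)
    finally show ?thesis by (simp add: nn_integral_cmult)
  qed
  have 2: "(\<integral>\<^sup>+z. g (fst z - snd z) * indicator K (snd z) \<partial>(lborel \<Otimes>\<^sub>M lborel))
      = (\<integral>\<^sup>+z. g z \<partial>lborel) * emeasure lborel K"
  proof -
    have "(\<integral>\<^sup>+z. g (fst z - snd z) * indicator K (snd z) \<partial>(lborel \<Otimes>\<^sub>M lborel))
      = (\<integral>\<^sup>+y. \<integral>\<^sup>+x. g (x - y) * indicator K y \<partial>lborel \<partial>lborel)"
      using lborel_pair.nn_integral_snd[OF m(2)] by simp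
    also have "\<dots> = (\<integral>\<^sup>+y. (\<integral>\<^sup>+z. g z \<partial>lborel) * indicator K y \<partial>lborel)"
      by (simp add: nn_integral_multc nn_integral_lborel_shift_diff)
    finally show ?thesis by (simp add: nn_integral_cmult)
  qed
  have "gagliardo_energy s p f \<le> (\<integral>\<^sup>+z. ?c * (g (snd z - fst z) * indicator K (fst z))
      + ?c * (g (fst z - snd z) * indicator K (snd z)) \<partial>(lborel \<Otimes>\<^sub>M lborel))"
    unfolding gagliardo_energy_lborel by (intro nn_integral_mono bound)
  also have "\<dots> = ?c * ((\<integral>\<^sup>+z. g z \<partial>lborel) * emeasure lborel K)
      + ?c * ((\<integral>\<^sup>+z. g z \<partial>lborel) * emeasure lborel K)"
    by (simp add: nn_integral_add nn_integral_cmult 1 2)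
  also have "\<dots> < \<infinity>"
    using Kfin gfin by (simp add: ennreal_mult_less_top)
  finally show ?thesis .
qed

section \<open>The Gagliardo seminorm\<close>

lemma AE_lborel_pair:
  assumes "AE x in lborel. P x"
  shows "AE z in lborel \<Otimes>\<^sub>M lborel. P (fst z) \<and> P (snd z)"
proof -
  obtain N where N: "N \<in> null_sets lborel" "\<And>x. x \<in> space lborel - N \<Longrightarrow> P x"
    using AE_E3[OF assms] by metis
  have "(N \<times> UNIV) \<union> (UNIV \<times> N) \<in> null_sets (lborel \<Otimes>\<^sub>M lborel)"
    using N by (intro null_sets.Un lborel.times_in_null_sets1 lborel.times_in_null_sets2) auto
  then show ?thesis
  proof (rule AE_I')
    have "P x" if "x \<notin> N" for x using N(2) that by simp
    then show "{z \<in> space (lborel \<Otimes>\<^sub>M lborel). \<not> (P (fst z) \<and> P (snd z))} \<subseteq> (N \<times> UNIV) \<union> (UNIV \<times> N)"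
      by force
  qed
qed

lemma gagliardo_energy_cong_AE:
  assumes "AE x in lborel. u x = v x"
  shows "gagliardo_energy s p u = gagliardo_energy s p v"
  unfolding gagliardo_energy_lborel gagliardo_integrand_def
  by (intro nn_integral_cong_AE) (use AE_lborel_pair[OF assms] in auto)

lemma gagliardo_energy_scale:
  assumes p: "1 < p" and [measurable]: "f \<in> borel_measurable borel"
  shows "gagliardo_energy s p (\<lambda>x. c * f x) = ennreal (\<bar>c\<bar> powr p) * gagliardo_energy s p f"
proof -
  have "gagliardo_integrand s p (\<lambda>x. c * f x) z = ennreal (\<bar>c\<bar> powr p) * gagliardo_integrand s p f z" for z
    unfolding gagliardo_integrand_def
    by (simp add: abs_mult powr_mult flip: right_diff_distrib ennreal_mult)
  then have "gagliardo_integrand s p (\<lambda>x. c * f x) = (\<lambda>z. ennreal (\<bar>c\<bar> powr p) * gagliardo_integrand s p f z)"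
    by blast
  then show ?thesis
    unfolding gagliardo_energy_lborel by (simp add: nn_integral_cmult)
qed

lemma gagliardo_norm_nonneg: "0 \<le> gagliardo_norm s p u"
  by (simp add: gagliardo_norm_def)

lemma gagliardo_energy_eq_norm:
  assumes p: "1 < p" and fin: "gagliardo_energy s p u < \<infinity>"
  shows "gagliardo_energy s p u = ennreal (gagliardo_norm s p u powr p)"
  using assms by (simp add: gagliardo_norm_def powr_powr)

lemma gagliardo_norm_le:
  assumes p: "1 < p" and a: "0 \<le> a" and le: "gagliardo_energy s p u \<le> ennreal (a powr p)"
  shows "gagliardo_norm s p u \<le> a"
proof -
  have "enn2real (gagliardo_energy s p u) \<le> a powr p"
    using enn2real_mono[OF le] by simp
  then have "gagliardo_norm s p u \<le> (a powr p) powr (1 / p)"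
    unfolding gagliardo_norm_def using p by (intro powr_mono2) auto
  then show ?thesis using p a by (simp add: powr_powr)
qed

lemma gagliardo_norm_scale:
  assumes p: "1 < p" and "f \<in> borel_measurable borel"
  shows "gagliardo_norm s p (\<lambda>x. c * f x) = \<bar>c\<bar> * gagliardo_norm s p f"
  unfolding gagliardo_norm_def gagliardo_energy_scale[OF assms]
  using p by (simp add: enn2real_mult powr_mult powr_powr)

text \<open>Positive upper bounds \<open>A\<close> and \<open>B\<close> may be used here in place of the seminorms themselves, which
  covers functions of seminorm \<open>0\<close> without a division by zero.\<close>

lemma gagliardo_energy_triangle:
  assumes p: "1 < p" and [measurable]: "f \<in> borel_measurable borel" "g \<in> borel_measurable borel"
    and fin: "gagliardo_energy s p f < \<infinity>" "gagliardo_energy s p g < \<infinity>"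
    and A: "gagliardo_norm s p f \<le> A" "0 < A" and B: "gagliardo_norm s p g \<le> B" "0 < B"
  shows "gagliardo_energy s p (\<lambda>x. f x + g x) \<le> ennreal ((A + B) powr p)"
proof -
  define a where "a = (A + B) powr p * (A / (A + B)) / A powr p"
  define b where "b = (A + B) powr p * (B / (A + B)) / B powr p"
  have ab: "0 \<le> a" "0 \<le> b" using A B by (simp_all add: a_def b_def)
  have pt: "\<bar>x + y\<bar> powr p \<le> a * \<bar>x\<bar> powr p + b * \<bar>y\<bar> powr p" for x y
  proof -
    have "\<bar>x + y\<bar> powr p \<le> (\<bar>x\<bar> + \<bar>y\<bar>) powr p"
      using p by (intro powr_mono2) auto
    also have "\<dots> \<le> (A + B) powr p * ((A / (A + B)) * (\<bar>x\<bar> / A) powr p + (B / (A + B)) * (\<bar>y\<bar> / B) powr p)"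
      using p A B by (intro powr_sum_le_weighted) auto
    also have "\<dots> = a * \<bar>x\<bar> powr p + b * \<bar>y\<bar> powr p"
      using A B by (simp add: a_def b_def powr_divide distrib_left)
    finally show ?thesis .
  qed
  have "gagliardo_integrand s p (\<lambda>x. f x + g x) z
      \<le> ennreal a * gagliardo_integrand s p f z + ennreal b * gagliardo_integrand s p g z" for z
  proof -
    define K where "K = norm (fst z - snd z) powr (real DIM('a) + s * p)"
    have "\<bar>(f (fst z) + g (fst z)) - (f (snd z) + g (snd z))\<bar> powr p / K
        \<le> (a * \<bar>f (fst z) - f (snd z)\<bar> powr p + b * \<bar>g (fst z) - g (snd z)\<bar> powr p) / K"
      using pt[of "f (fst z) - f (snd z)" "g (fst z) - g (snd z)"]
      by (intro divide_right_mono) (auto simp: K_def algebra_simps)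
    also have "\<dots> = a * (\<bar>f (fst z) - f (snd z)\<bar> powr p / K) + b * (\<bar>g (fst z) - g (snd z)\<bar> powr p / K)"
      by (simp add: add_divide_distrib)
    finally show ?thesis
      unfolding gagliardo_integrand_def K_def[symmetric] using ab
      by (simp add: K_def flip: ennreal_mult ennreal_plus)
  qed
  then have "gagliardo_energy s p (\<lambda>x. f x + g x)
      \<le> (\<integral>\<^sup>+z. ennreal a * gagliardo_integrand s p f z + ennreal b * gagliardo_integrand s p g z \<partial>(lborel \<Otimes>\<^sub>M lborel))"
    unfolding gagliardo_energy_lborel by (intro nn_integral_mono)
  also have "\<dots> = ennreal a * gagliardo_energy s p f + ennreal b * gagliardo_energy s p g"
    unfolding gagliardo_energy_lborel by (simp add: nn_integral_add nn_integral_cmult)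
  also have "\<dots> = ennreal (a * gagliardo_norm s p f powr p + b * gagliardo_norm s p g powr p)"
    using ab by (simp add: gagliardo_energy_eq_norm[OF p fin(1)] gagliardo_energy_eq_norm[OF p fin(2)] ennreal_mult)
  also have "\<dots> \<le> ennreal (a * A powr p + b * B powr p)"
    using ab A B p by (intro ennreal_leI add_mono mult_left_mono powr_mono2 gagliardo_norm_nonneg) auto
  also have "a * A powr p + b * B powr p = (A + B) powr p * (A / (A + B) + B / (A + B))"
    using A B by (simp add: a_def b_def distrib_left)
  also have "A / (A + B) + B / (A + B) = 1"
    using A B by (simp flip: add_divide_distrib)
  finally show ?thesis by simp
qed

lemma gagliardo_energy_add_finite:
  assumes "1 < p" "f \<in> borel_measurable borel" "g \<in> borel_measurable borel"
    and "gagliardo_energy s p f < \<infinity>" "gagliardo_energy s p g < \<infinity>"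
  shows "gagliardo_energy s p (\<lambda>x. f x + g x) < \<infinity>"
proof -
  have "gagliardo_energy s p (\<lambda>x. f x + g x)
      \<le> ennreal (((gagliardo_norm s p f + 1) + (gagliardo_norm s p g + 1)) powr p)"
    using gagliardo_norm_nonneg[of s p f] gagliardo_norm_nonneg[of s p g]
    by (intro gagliardo_energy_triangle[OF assms]) auto
  also have "\<dots> < \<infinity>" by simp
  finally show ?thesis .
qed

lemma gagliardo_norm_triangle:
  assumes p: "1 < p" and "f \<in> borel_measurable borel" "g \<in> borel_measurable borel"
    and "gagliardo_energy s p f < \<infinity>" "gagliardo_energy s p g < \<infinity>"
  shows "gagliardo_norm s p (\<lambda>x. f x + g x) \<le> gagliardo_norm s p f + gagliardo_norm s p g"
proof (rule field_le_epsilon)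
  fix e :: real assume e: "0 < e"
  have "gagliardo_norm s p (\<lambda>x. f x + g x) \<le> (gagliardo_norm s p f + e / 2) + (gagliardo_norm s p g + e / 2)"
    using e gagliardo_norm_nonneg[of s p f] gagliardo_norm_nonneg[of s p g]
    by (intro gagliardo_norm_le[OF p _ gagliardo_energy_triangle[OF assms]]) auto
  then show "gagliardo_norm s p (\<lambda>x. f x + g x) \<le> gagliardo_norm s p f + gagliardo_norm s p g + e"
    by simp
qed

lemma gagliardo_norm_minus_commute:
  "gagliardo_norm s p (\<lambda>x. f x - g x) = gagliardo_norm s p (\<lambda>x. g x - f x)"
proof -
  have "\<bar>(f x - g x) - (f y - g y)\<bar> = \<bar>(g x - f x) - (g y - f y)\<bar>" for x y
    by linarith
  then show ?thesis
    by (simp only: gagliardo_norm_def gagliardo_energy_def)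
qed

lemma gagliardo_norm_diff_le:
  assumes p: "1 < p" and [measurable]: "f \<in> borel_measurable borel" "g \<in> borel_measurable borel"
    and f: "gagliardo_energy s p f < \<infinity>" and g: "gagliardo_energy s p g < \<infinity>"
  shows "\<bar>gagliardo_norm s p f - gagliardo_norm s p g\<bar> \<le> gagliardo_norm s p (\<lambda>x. f x - g x)"
proof -
  have *: "gagliardo_norm s p f \<le> gagliardo_norm s p (\<lambda>x. f x - g x) + gagliardo_norm s p g"
    if [measurable]: "f \<in> borel_measurable borel" "g \<in> borel_measurable borel"
      and f: "gagliardo_energy s p f < \<infinity>" and g: "gagliardo_energy s p g < \<infinity>" for f g :: "'a \<Rightarrow> real"
  proof -
    have "gagliardo_energy s p (\<lambda>x. (- 1) * g x) < \<infinity>"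
      using g by (subst gagliardo_energy_scale) (auto simp: p)
    then have "gagliardo_energy s p (\<lambda>x. f x + (- 1) * g x) < \<infinity>"
      using f p by (intro gagliardo_energy_add_finite) auto
    then have "gagliardo_norm s p (\<lambda>x. (f x - g x) + g x)
        \<le> gagliardo_norm s p (\<lambda>x. f x - g x) + gagliardo_norm s p g"
      using g p by (intro gagliardo_norm_triangle) auto
    then show ?thesis by simp
  qed
  show ?thesis
    using *[of f g] *[of g f] f g gagliardo_norm_minus_commute[of s p f g] by simp
qed

section \<open>Elements of the completion as limits of test functions\<close>

lemma gagliardo_norm_zero: "gagliardo_norm s p (\<lambda>x. 0) = 0"
  by (simp add: gagliardo_norm_def gagliardo_energy_lborel gagliardo_integrand_def)

lemma test_functions_diff:
  assumes "f \<in> test_functions \<Omega>" "g \<in> test_functions \<Omega>"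
  shows "(\<lambda>x. f x - g x) \<in> test_functions \<Omega>"
  using test_functions_linear[OF assms, of 1 "-1"] by simp

lemma constant_cauchy_tests:
  "f \<in> test_functions \<Omega> \<Longrightarrow> (\<lambda>n. f) \<in> cauchy_tests s p \<Omega>"
  by (simp add: cauchy_tests_def gagliardo_norm_zero)

lemma D0_class_in_D0: "\<phi> \<in> cauchy_tests s p \<Omega> \<Longrightarrow> D0_class s p \<Omega> \<phi> \<in> D0 s p \<Omega>"
  by (simp add: D0_def D0_class_def quotientI)

text \<open>\<open>D0_norm\<close> is computed from an arbitrarily chosen representative \<open>\<psi>\<close> of the class. Its seminorms form a
  Cauchy sequence of reals, so their limit exists, and they differ from those of \<open>\<theta>\<close> by a null
  sequence.\<close>

lemma D0_norm_class_le:
  fixes \<theta> :: "nat \<Rightarrow> 'a::euclidean_space \<Rightarrow> real"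
  assumes p: "1 < p" and s: "0 < s" "s < 1"
    and \<theta>: "\<theta> \<in> cauchy_tests s p \<Omega>"
    and B: "\<forall>\<^sub>F n in sequentially. gagliardo_norm s p (\<theta> n) \<le> B"
  shows "D0_norm s p (D0_class s p \<Omega> \<theta>) \<le> B"
proof -
  let ?g = "gagliardo_norm s p"
  define \<psi> where "\<psi> = (SOME \<psi>. \<psi> \<in> D0_class s p \<Omega> \<theta>)"
  have "\<theta> \<in> D0_class s p \<Omega> \<theta>"
    using \<theta> by (simp add: D0_class_def cauchy_rel_def gagliardo_norm_zero)
  then have "\<psi> \<in> D0_class s p \<Omega> \<theta>" 
    unfolding \<psi>_def by (rule someI[where P = "\<lambda>\<psi>. \<psi> \<in> D0_class s p \<Omega> \<theta>"])
  then have \<psi>: "\<psi> \<in> cauchy_tests s p \<Omega>" and lim: "(\<lambda>n. ?g (\<lambda>x. \<theta> n x - \<psi> n x)) \<longlonglongrightarrow> 0"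
    by (simp_all add: D0_class_def cauchy_rel_def)
  have test: "\<theta> n \<in> test_functions \<Omega>" "\<psi> n \<in> test_functions \<Omega>" for n
    using \<theta> \<psi> by (simp_all add: cauchy_tests_def)
  have diff: "\<bar>?g f - ?g h\<bar> \<le> ?g (\<lambda>x. f x - h x)"
    if "f \<in> test_functions \<Omega>" "h \<in> test_functions \<Omega>" for f h
    using that by (intro gagliardo_norm_diff_le p test_function_borel test_function_energy_finite s)
  have "Cauchy (\<lambda>n. ?g (\<psi> n))"
  proof (rule metric_CauchyI)
    fix e :: real assume "0 < e"
    then obtain M where "\<forall>m\<ge>M. \<forall>n\<ge>M. ?g (\<lambda>x. \<psi> m x - \<psi> n x) < e"
      using \<psi> by (auto simp: cauchy_tests_def)
    then show "\<exists>M. \<forall>m\<ge>M. \<forall>n\<ge>M. dist (?g (\<psi> m)) (?g (\<psi> n)) < e"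
      using diff[OF test(2) test(2)] by (metis dist_real_def le_less_trans)
  qed
  then obtain l where l: "(\<lambda>n. ?g (\<psi> n)) \<longlonglongrightarrow> l"
    using real_Cauchy_convergent convergent_def by blast
  have "D0_norm s p (D0_class s p \<Omega> \<theta>) = l"
    unfolding D0_norm_def \<psi>_def[symmetric] using l by (rule limI)
  moreover have "l \<le> B"
  proof (rule tendsto_le[OF sequentially_bot _ l])
    show "(\<lambda>n. B + ?g (\<lambda>x. \<theta> n x - \<psi> n x)) \<longlonglongrightarrow> B"
      using tendsto_add[OF tendsto_const[of B] lim] by simp
    show "\<forall>\<^sub>F n in sequentially. ?g (\<psi> n) \<le> B + ?g (\<lambda>x. \<theta> n x - \<psi> n x)"
      using B
    proof eventually_elim
      case (elim n)
      then show ?case using diff[OF test, of n n] by linarith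
    qed
  qed
  ultimately show ?thesis by simp
qed

lemma cauchy_tests_affine:
  assumes p: "1 < p" and \<phi>: "\<phi> \<in> cauchy_tests s p \<Omega>" and f: "f \<in> test_functions \<Omega>"
  shows "(\<lambda>n x. a * \<phi> n x + b * f x) \<in> cauchy_tests s p \<Omega>"
proof -
  have t: "\<phi> n \<in> test_functions \<Omega>" for n using \<phi> by (simp add: cauchy_tests_def)
  have eq: "gagliardo_norm s p (\<lambda>x. (a * \<phi> m x + b * f x) - (a * \<phi> n x + b * f x))
      = \<bar>a\<bar> * gagliardo_norm s p (\<lambda>x. \<phi> m x - \<phi> n x)" for m n
    using gagliardo_norm_scale[OF p test_function_borel[OF test_functions_diff[OF t t]], of s a m n]
    by (simp add: right_diff_distrib)
  have "\<exists>M. \<forall>m\<ge>M. \<forall>n\<ge>M. \<bar>a\<bar> * gagliardo_norm s p (\<lambda>x. \<phi> m x - \<phi> n x) < e" if e: "0 < e" for e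
  proof -
    have "0 < e / (\<bar>a\<bar> + 1)" using e by (simp add: add_nonneg_pos)
    then obtain M where M: "\<forall>m\<ge>M. \<forall>n\<ge>M. gagliardo_norm s p (\<lambda>x. \<phi> m x - \<phi> n x) < e / (\<bar>a\<bar> + 1)"
      using \<phi> unfolding cauchy_tests_def by blast
    have "\<bar>a\<bar> * gagliardo_norm s p (\<lambda>x. \<phi> m x - \<phi> n x) < e" if "m \<ge> M" "n \<ge> M" for m n
    proof -
      have "gagliardo_norm s p (\<lambda>x. \<phi> m x - \<phi> n x) < e / (\<bar>a\<bar> + 1)" using M that by blast
      then have "gagliardo_norm s p (\<lambda>x. \<phi> m x - \<phi> n x) * (\<bar>a\<bar> + 1) < e"
        by (simp add: less_divide_eq add_nonneg_pos)
      then show ?thesis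
        using gagliardo_norm_nonneg[of s p "\<lambda>x. \<phi> m x - \<phi> n x"] by (simp add: algebra_simps)
    qed
    then show ?thesis by blast
  qed
  then show ?thesis
    unfolding cauchy_tests_def mem_Collect_eq eq using test_functions_linear[OF t f] by blast
qed

lemma test_function_integrable:
  fixes f :: "'a::euclidean_space \<Rightarrow> real"
  assumes f: "f \<in> test_functions \<Omega>"
  shows "integrable lebesgue f"
proof -
  let ?K = "closure {x. f x \<noteq> 0}"
  have "compact ?K" using f by (simp add: test_functions_def)
  then have "integrable lborel (\<lambda>x. indicator ?K x *\<^sub>R f x)"
    by (intro borel_integrable_compact continuous_on_subset[OF test_function_continuous[OF f]]) auto
  moreover have "(\<lambda>x. indicator ?K x *\<^sub>R f x) = f"
    using closure_subset[of "{x. f x \<noteq> 0}"] by (auto simp: indicator_def fun_eq_iff)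
  ultimately show ?thesis
    using test_function_borel[OF f] by (simp add: integrable_completion)
qed

text \<open>A compact operator is bounded; this is the sequential form of that fact for the tails of \<open>\<phi>\<close>. Along
  a fast subsequence \<open>K\<close>, the differences between the class of \<open>\<phi>\<close> and that of the constant
  sequence \<open>\<phi> (K j)\<close> stay in the unit ball even after multiplication by \<open>j + 1\<close>. By compactness
  some of their images converge in \<open>L\<^sup>1\<close>, hence are bounded in \<open>L\<^sup>1\<close>, and division by \<open>j + 1\<close> makes them
  vanish in the limit.\<close>

lemma compact_embedding_L1_limit:
  fixes \<Omega> :: "'a::euclidean_space set"
  assumes p: "1 < p" and s: "0 < s" "s < 1" and \<Omega>: "open \<Omega>"
    and J: "compact_embedding s p \<Omega> J" and \<phi>: "\<phi> \<in> cauchy_tests s p \<Omega>"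
  obtains r where "strict_mono r"
    and "(\<lambda>k. \<integral>\<^sup>+x\<in>\<Omega>. ennreal \<bar>\<phi> (r k) x - J (D0_class s p \<Omega> \<phi>) x\<bar> \<partial>lebesgue) \<longlonglongrightarrow> 0"
proof -
  let ?g = "gagliardo_norm s p"
  let ?u = "J (D0_class s p \<Omega> \<phi>)"
  have \<Omega>s [measurable]: "\<Omega> \<in> sets lebesgue" using \<Omega> by simp
  have t: "\<phi> n \<in> test_functions \<Omega>" for n using \<phi> by (simp add: cauchy_tests_def)
  have "\<exists>M. \<forall>m\<ge>M. \<forall>n\<ge>M. ?g (\<lambda>x. \<phi> m x - \<phi> n x) < 1 / (real j + 1)" for j :: nat
  proof -
    have "0 < 1 / (real j + 1)" by simp
    then show ?thesis using \<phi> unfolding cauchy_tests_def by blast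
  qed
  then obtain M where M: "\<And>j m n. m \<ge> M j \<Longrightarrow> n \<ge> M j \<Longrightarrow> ?g (\<lambda>x. \<phi> m x - \<phi> n x) < 1 / (real j + 1)"
    by metis
  \<comment> \<open>Partial sums turn the thresholds \<open>M\<close> into a strictly increasing sequence above them.\<close>
  define K where "K = (\<lambda>j. (\<Sum>i\<le>j. M i) + j)"
  have K: "strict_mono K" by (auto simp: K_def strict_mono_Suc_iff)
  have KM: "M j \<le> K j" for j
    using member_le_sum[of j "{..j}" M] by (simp add: K_def)
  define \<theta> where "\<theta> = (\<lambda>j n x. (real j + 1) * \<phi> n x + (- (real j + 1)) * \<phi> (K j) x)"
  define X where "X = (\<lambda>j. D0_class s p \<Omega> (\<theta> j))"
  have \<theta>c: "\<theta> j \<in> cauchy_tests s p \<Omega>" for j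
    unfolding \<theta>_def by (intro cauchy_tests_affine p \<phi> t)
  then have X: "X j \<in> D0 s p \<Omega>" for j unfolding X_def by (intro D0_class_in_D0)
  have norm: "D0_norm s p (X j) \<le> 1" for j
    unfolding X_def
  proof (rule D0_norm_class_le[OF p s \<theta>c])
    have "?g (\<theta> j n) \<le> 1" if n: "n \<ge> K j" for n
    proof -
      have "\<theta> j n = (\<lambda>x. (real j + 1) * (\<phi> n x - \<phi> (K j) x))"
        by (simp add: \<theta>_def fun_eq_iff algebra_simps)
      then have "?g (\<theta> j n) = (real j + 1) * ?g (\<lambda>x. \<phi> n x - \<phi> (K j) x)"
        using gagliardo_norm_scale[OF p test_function_borel[OF test_functions_diff[OF t t]], of s "real j + 1" n "K j"]
        by simp
      also have "\<dots> \<le> (real j + 1) * (1 / (real j + 1))"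
        using M[of j n "K j"] KM[of j] n by (intro mult_left_mono) auto
      finally show ?thesis by simp
    qed
    then show "\<forall>\<^sub>F n in sequentially. ?g (\<theta> j n) \<le> 1"
      unfolding eventually_sequentially by blast
  qed
  have Jint: "\<forall>X\<in>D0 s p \<Omega>. set_integrable lebesgue \<Omega> (J X)"
    and Jlin: "\<forall>a b. \<forall>\<phi>\<in>cauchy_tests s p \<Omega>. \<forall>\<psi>\<in>cauchy_tests s p \<Omega>. AE x in lebesgue. x \<in> \<Omega> \<longrightarrow>
        J (D0_class s p \<Omega> (\<lambda>n x. a * \<phi> n x + b * \<psi> n x)) x =
          a * J (D0_class s p \<Omega> \<phi>) x + b * J (D0_class s p \<Omega> \<psi>) x"
    and Jext: "\<forall>f\<in>test_functions \<Omega>. AE x in lebesgue. x \<in> \<Omega> \<longrightarrow> J (D0_class s p \<Omega> (\<lambda>n. f)) x = f x"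
    and Jcomp: "\<forall>X. (\<forall>k. X k \<in> D0 s p \<Omega>) \<and> (\<exists>B. \<forall>k. D0_norm s p (X k) \<le> B) \<longrightarrow>
        (\<exists>r g. strict_mono (r :: nat \<Rightarrow> nat) \<and> set_integrable lebesgue \<Omega> g \<and>
           (\<lambda>k. \<integral>\<^sup>+x\<in>\<Omega>. ennreal \<bar>J (X (r k)) x - g x\<bar> \<partial>lebesgue) \<longlonglongrightarrow> 0)"
    using J unfolding compact_embedding_def by blast+
  have JX: "AE x in lebesgue. x \<in> \<Omega> \<longrightarrow> J (X j) x = (real j + 1) * (?u x - \<phi> (K j) x)" for j
  proof -
    have "AE x in lebesgue. x \<in> \<Omega> \<longrightarrow> J (X j) x
        = (real j + 1) * ?u x + (- (real j + 1)) * J (D0_class s p \<Omega> (\<lambda>n. \<phi> (K j))) x"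
      unfolding X_def \<theta>_def
      by (rule bspec[OF bspec[OF spec[OF spec[OF Jlin]] \<phi>] constant_cauchy_tests[OF t]])
    moreover have "AE x in lebesgue. x \<in> \<Omega> \<longrightarrow> J (D0_class s p \<Omega> (\<lambda>n. \<phi> (K j))) x = \<phi> (K j) x"
      by (rule bspec[OF Jext t])
    ultimately show ?thesis
      by eventually_elim (simp add: algebra_simps)
  qed
  obtain r g where r: "strict_mono r" and g: "set_integrable lebesgue \<Omega> g"
    and lim: "(\<lambda>k. \<integral>\<^sup>+x\<in>\<Omega>. ennreal \<bar>J (X (r k)) x - g x\<bar> \<partial>lebesgue) \<longlonglongrightarrow> 0"
    using Jcomp[rule_format, of X] X norm by blast
  have g_meas [measurable]: "(\<lambda>x. indicator \<Omega> x *\<^sub>R g x) \<in> borel_measurable lebesgue"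
    using g unfolding set_integrable_def by (rule borel_measurable_integrable)
  have J_meas [measurable]: "(\<lambda>x. indicator \<Omega> x *\<^sub>R J (X j) x) \<in> borel_measurable lebesgue" for j
    using Jint X unfolding set_integrable_def by (blast intro: borel_measurable_integrable)
  define G where "G = (\<integral>\<^sup>+x. ennreal \<bar>indicator \<Omega> x *\<^sub>R g x\<bar> \<partial>lebesgue)"
  have G: "G < \<infinity>"
    using g unfolding set_integrable_def integrable_iff_bounded G_def by simp
  define A where "A = (\<lambda>k. \<integral>\<^sup>+x. ennreal \<bar>indicator \<Omega> x *\<^sub>R J (X (r k)) x - indicator \<Omega> x *\<^sub>R g x\<bar> \<partial>lebesgue)"
  have A: "A \<longlonglongrightarrow> 0"
  proof -
    have "A = (\<lambda>k. \<integral>\<^sup>+x\<in>\<Omega>. ennreal \<bar>J (X (r k)) x - g x\<bar> \<partial>lebesgue)"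
      unfolding A_def by (intro ext nn_integral_cong) (auto simp: indicator_def)
    then show ?thesis using lim by simp
  qed
  have abs_split: "ennreal \<bar>a\<bar> \<le> ennreal \<bar>a - b\<bar> + ennreal \<bar>b\<bar>" for a b :: real
    using ennreal_leI[of "\<bar>a\<bar>" "\<bar>a - b\<bar> + \<bar>b\<bar>"] by simp
  have le: "(\<integral>\<^sup>+x\<in>\<Omega>. ennreal \<bar>\<phi> (K (r k)) x - ?u x\<bar> \<partial>lebesgue) \<le> ennreal (1 / (real (r k) + 1)) * (A k + G)" for k
  proof -
    let ?j = "r k"
    have "(\<integral>\<^sup>+x\<in>\<Omega>. ennreal \<bar>\<phi> (K ?j) x - ?u x\<bar> \<partial>lebesgue)
        = (\<integral>\<^sup>+x. ennreal (1 / (real ?j + 1)) * ennreal \<bar>indicator \<Omega> x *\<^sub>R J (X ?j) x\<bar> \<partial>lebesgue)"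
    proof (rule nn_integral_cong_AE)
      show "AE x in lebesgue. ennreal \<bar>\<phi> (K ?j) x - ?u x\<bar> * indicator \<Omega> x
          = ennreal (1 / (real ?j + 1)) * ennreal \<bar>indicator \<Omega> x *\<^sub>R J (X ?j) x\<bar>"
        using JX[of ?j]
      proof eventually_elim
        case (elim x)
        have "\<bar>\<phi> (K ?j) x - ?u x\<bar> = 1 / (real ?j + 1) * \<bar>(real ?j + 1) * (?u x - \<phi> (K ?j) x)\<bar>"
          by (simp add: abs_mult abs_minus_commute)
        then show ?case
          using elim by (cases "x \<in> \<Omega>") (simp_all flip: ennreal_mult)
      qed
    qed
    also have "\<dots> = ennreal (1 / (real ?j + 1)) * (\<integral>\<^sup>+x. ennreal \<bar>indicator \<Omega> x *\<^sub>R J (X ?j) x\<bar> \<partial>lebesgue)"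
      by (intro nn_integral_cmult) measurable
    also have "(\<integral>\<^sup>+x. ennreal \<bar>indicator \<Omega> x *\<^sub>R J (X ?j) x\<bar> \<partial>lebesgue)
        \<le> (\<integral>\<^sup>+x. ennreal \<bar>indicator \<Omega> x *\<^sub>R J (X ?j) x - indicator \<Omega> x *\<^sub>R g x\<bar>
            + ennreal \<bar>indicator \<Omega> x *\<^sub>R g x\<bar> \<partial>lebesgue)"
      by (intro nn_integral_mono abs_split)
    also have "\<dots> = A k + G"
      unfolding A_def G_def by (intro nn_integral_add) measurable
    finally show ?thesis by (simp add: mult_left_mono)
  qed
  have "(\<lambda>k. ennreal (1 / (real (r k) + 1)) * (A k + G)) \<longlonglongrightarrow> ennreal 0 * (0 + G)"
  proof (intro tendsto_mult_ennreal tendsto_ennrealI tendsto_add A tendsto_const)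
    have "(\<lambda>n. 1 / (real n + 1)) \<longlonglongrightarrow> 0"
      using LIMSEQ_inverse_real_of_nat by (simp add: inverse_eq_divide add.commute)
    from LIMSEQ_subseq_LIMSEQ[OF this r] show "(\<lambda>k. 1 / (real (r k) + 1)) \<longlonglongrightarrow> 0"
      by (simp add: o_def)
  qed (use G in auto)
  then have lim0: "(\<lambda>k. ennreal (1 / (real (r k) + 1)) * (A k + G)) \<longlonglongrightarrow> 0" by simp
  have "(\<lambda>k. \<integral>\<^sup>+x\<in>\<Omega>. ennreal \<bar>\<phi> ((K \<circ> r) k) x - ?u x\<bar> \<partial>lebesgue) \<longlonglongrightarrow> 0"
    by (rule tendsto_sandwich[OF _ _ tendsto_const lim0]) (use le in auto)
  moreover have "strict_mono (K \<circ> r)" using K r by (rule strict_mono_o)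
  ultimately show thesis by (rule that[rotated])
qed

text \<open>By Fatou, the energy of \<open>\<phi> m - u\<close> is at most the lower limit over \<open>n\<close> of the energies of
  \<open>\<phi> m - \<phi> n\<close>, which is small because the sequence is Cauchy. So \<open>\<phi>\<close> converges to \<open>u\<close> in the seminorm,
  not only almost everywhere; Fatou applied to \<open>\<phi>\<close> itself would bound the energy of \<open>u\<close> from above only,
  whereas the minimality argument needs the energies of \<open>\<phi> n\<close> to come down to that of \<open>u\<close>.\<close>

lemma cauchy_tests_energy_limit:
  fixes \<phi> :: "nat \<Rightarrow> 'a::euclidean_space \<Rightarrow> real"
  assumes p: "1 < p" and s: "0 < s" "s < 1"
    and \<phi>: "\<phi> \<in> cauchy_tests s p \<Omega>"
    and u [measurable]: "u \<in> borel_measurable borel"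
    and ae: "AE x in lborel. (\<lambda>n. \<phi> n x) \<longlonglongrightarrow> u x"
  shows "gagliardo_energy s p u < \<infinity>" and "(\<lambda>n. gagliardo_norm s p (\<phi> n)) \<longlonglongrightarrow> gagliardo_norm s p u"
proof -
  let ?g = "gagliardo_norm s p" and ?E = "gagliardo_energy s p"
  have t: "\<phi> n \<in> test_functions \<Omega>" for n using \<phi> by (simp add: cauchy_tests_def)
  have b [measurable]: "\<phi> n \<in> borel_measurable borel" for n by (rule test_function_borel[OF t])
  have fin: "?E (\<phi> n) < \<infinity>" for n by (rule test_function_energy_finite[OF p s t])
  have dfin: "?E (\<lambda>x. \<phi> m x - \<phi> n x) < \<infinity>" for m n
    by (rule test_function_energy_finite[OF p s test_functions_diff[OF t t]])
  have key: "?E (\<lambda>x. \<phi> m x - u x) \<le> ennreal (e powr p)"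
    if e: "0 < e" and M: "\<forall>n\<ge>M. ?g (\<lambda>x. \<phi> m x - \<phi> n x) < e" for e m M
  proof -
    let ?I = "\<lambda>f. gagliardo_integrand s p f"
    have "AE z in lborel \<Otimes>\<^sub>M lborel. ?I (\<lambda>x. \<phi> m x - u x) z = liminf (\<lambda>n. ?I (\<lambda>x. \<phi> m x - \<phi> n x) z)"
      using AE_lborel_pair[OF ae]
    proof eventually_elim
      case (elim z)
      then have "(\<lambda>n. ?I (\<lambda>x. \<phi> m x - \<phi> n x) z) \<longlonglongrightarrow> ?I (\<lambda>x. \<phi> m x - u x) z"
        unfolding gagliardo_integrand_def divide_inverse using p
        by (intro tendsto_ennrealI tendsto_mult_right tendsto_powr2 tendsto_const tendsto_rabs tendsto_diff) auto
      then show ?case by (simp add: lim_imp_Liminf)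
    qed
    then have "?E (\<lambda>x. \<phi> m x - u x) = (\<integral>\<^sup>+z. liminf (\<lambda>n. ?I (\<lambda>x. \<phi> m x - \<phi> n x) z) \<partial>(lborel \<Otimes>\<^sub>M lborel))"
      unfolding gagliardo_energy_lborel by (rule nn_integral_cong_AE)
    also have "\<dots> \<le> liminf (\<lambda>n. ?E (\<lambda>x. \<phi> m x - \<phi> n x))"
      unfolding gagliardo_energy_lborel by (intro nn_integral_liminf) measurable
    also have "\<dots> \<le> limsup (\<lambda>n. ?E (\<lambda>x. \<phi> m x - \<phi> n x))"
      by (intro Liminf_le_Limsup) simp
    also have "\<dots> \<le> ennreal (e powr p)"
    proof (rule Limsup_bounded)
      have "?E (\<lambda>x. \<phi> m x - \<phi> n x) \<le> ennreal (e powr p)" if "n \<ge> M" for n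
        unfolding gagliardo_energy_eq_norm[OF p dfin] using M that p
        by (intro ennreal_leI powr_mono2 gagliardo_norm_nonneg) (auto intro: less_imp_le)
      then show "\<forall>\<^sub>F n in sequentially. ?E (\<lambda>x. \<phi> m x - \<phi> n x) \<le> ennreal (e powr p)"
        unfolding eventually_sequentially by blast
    qed
    finally show ?thesis .
  qed
  have close: "\<exists>M. \<forall>m\<ge>M. ?E (\<lambda>x. \<phi> m x - u x) \<le> ennreal (e powr p)" if e: "0 < e" for e
  proof -
    obtain M where "\<forall>m\<ge>M. \<forall>n\<ge>M. ?g (\<lambda>x. \<phi> m x - \<phi> n x) < e"
      using \<phi> e unfolding cauchy_tests_def by blast
    then show ?thesis using key[OF e] by blast
  qed
  obtain M where M: "?E (\<lambda>x. \<phi> M x - u x) \<le> ennreal (1 powr p)" using close[of 1] by auto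
  have "?E (\<lambda>x. (- 1) * (\<phi> M x - u x)) < \<infinity>"
    using le_less_trans[OF M] by (subst gagliardo_energy_scale[OF p]) auto
  then have "?E (\<lambda>x. (- 1) * (\<phi> M x - u x) + \<phi> M x) < \<infinity>"
    by (intro gagliardo_energy_add_finite p fin) auto
  then show ufin: "?E u < \<infinity>" by simp
  show "(\<lambda>n. ?g (\<phi> n)) \<longlonglongrightarrow> ?g u"
  proof (rule metric_LIMSEQ_I)
    fix e :: real assume e: "0 < e"
    then obtain M where M: "\<forall>m\<ge>M. ?E (\<lambda>x. \<phi> m x - u x) \<le> ennreal ((e / 2) powr p)"
      using close[of "e / 2"] by auto
    have "dist (?g (\<phi> n)) (?g u) < e" if "n \<ge> M" for n
    proof -
      have "\<bar>?g (\<phi> n) - ?g u\<bar> \<le> ?g (\<lambda>x. \<phi> n x - u x)"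
        by (intro gagliardo_norm_diff_le p b u fin ufin)
      also have "\<dots> \<le> e / 2" using M that e by (intro gagliardo_norm_le p) auto
      finally show ?thesis using e by (simp add: dist_real_def)
    qed
    then show "\<exists>M. \<forall>n\<ge>M. dist (?g (\<phi> n)) (?g u) < e" by blast
  qed
qed

text \<open>The \<open>L\<^sup>1\<close> convergence given by the compact embedding becomes convergence almost everywhere along a
  subsequence, which is still Cauchy in the seminorm. The Borel version \<open>u'\<close> is needed because
  \<open>u\<close> is only Lebesgue measurable, while the double integrals are treated as integrals over
  the product of two Borel measure spaces.\<close>

lemma D0_functions_approx:
  fixes \<Omega> :: "'a::euclidean_space set"
  assumes p: "1 < p" and s: "0 < s" "s < 1" and \<Omega>: "open \<Omega>"
    and J: "compact_embedding s p \<Omega> J" and u: "u \<in> D0_functions s p \<Omega> J"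
  shows "\<exists>\<phi> u'. (\<forall>n. \<phi> n \<in> test_functions \<Omega>) \<and>
    u' \<in> borel_measurable borel \<and> (AE x in lborel. u x = u' x) \<and>
    (AE x in lborel. (\<lambda>n. \<phi> n x) \<longlonglongrightarrow> u' x) \<and>
    gagliardo_energy s p u < \<infinity> \<and>
    (\<lambda>n. gagliardo_norm s p (\<phi> n)) \<longlonglongrightarrow> gagliardo_norm s p u \<and>
    set_integrable lebesgue \<Omega> u"
proof -
  have out: "\<And>x. x \<notin> \<Omega> \<Longrightarrow> u x = 0" using u by (simp add: D0_functions_def)
  obtain X where X: "X \<in> D0 s p \<Omega>" and uX: "AE x in lebesgue. x \<in> \<Omega> \<longrightarrow> u x = J X x"
    using u by (auto simp: D0_functions_def)
  obtain \<phi> where \<phi>: "\<phi> \<in> cauchy_tests s p \<Omega>" and X_eq: "X = D0_class s p \<Omega> \<phi>"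
    using X by (auto simp: D0_def D0_class_def elim: quotientE)
  have t: "\<phi> n \<in> test_functions \<Omega>" for n using \<phi> by (simp add: cauchy_tests_def)
  have \<Omega>s [measurable]: "\<Omega> \<in> sets lebesgue" using \<Omega> by simp
  have Jint: "integrable lebesgue (\<lambda>x. indicator \<Omega> x *\<^sub>R J X x)"
    using J X unfolding compact_embedding_def set_integrable_def by blast
  obtain r where r: "strict_mono r"
    and lim: "(\<lambda>k. \<integral>\<^sup>+x\<in>\<Omega>. ennreal \<bar>\<phi> (r k) x - J X x\<bar> \<partial>lebesgue) \<longlonglongrightarrow> 0"
    by (rule compact_embedding_L1_limit[OF p s \<Omega> J \<phi>, folded X_eq])
  define d where "d = (\<lambda>k x. \<phi> (r k) x - indicator \<Omega> x *\<^sub>R J X x)"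
  have d: "integrable lebesgue (d k)" for k
    unfolding d_def by (intro Bochner_Integration.integrable_diff test_function_integrable[OF t] Jint)
  have "(\<lambda>k. \<integral>x. norm (d k x) \<partial>lebesgue) \<longlonglongrightarrow> 0"
  proof -
    have "ennreal (\<integral>x. norm (d k x) \<partial>lebesgue) = (\<integral>\<^sup>+x\<in>\<Omega>. ennreal \<bar>\<phi> (r k) x - J X x\<bar> \<partial>lebesgue)" for k
    proof -
      have "ennreal (\<integral>x. norm (d k x) \<partial>lebesgue) = (\<integral>\<^sup>+x. ennreal (norm (d k x)) \<partial>lebesgue)"
        by (rule nn_integral_eq_integral[symmetric]) (use d in auto)
      also have "\<dots> = (\<integral>\<^sup>+x\<in>\<Omega>. ennreal \<bar>\<phi> (r k) x - J X x\<bar> \<partial>lebesgue)"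
        using test_function_outside[OF t]
        by (intro nn_integral_cong) (auto simp: d_def indicator_def)
      finally show ?thesis .
    qed
    then have "(\<lambda>k. ennreal (\<integral>x. norm (d k x) \<partial>lebesgue)) \<longlonglongrightarrow> ennreal 0" using lim by simp
    then show ?thesis by (subst (asm) tendsto_ennreal_iff) auto
  qed
  from tendsto_L1_AE_subseq[OF d this] obtain r' where r': "strict_mono r'"
    and ae: "AE x in lebesgue. (\<lambda>k. d (r' k) x) \<longlonglongrightarrow> 0" by blast
  define v where "v = (\<lambda>n. \<phi> (r (r' n)))"
  have vt: "v n \<in> test_functions \<Omega>" for n unfolding v_def by (rule t)
  have [measurable]: "v n \<in> borel_measurable borel" for n by (rule test_function_borel[OF vt])
  have vc: "v \<in> cauchy_tests s p \<Omega>"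
  proof -
    have "n \<le> r (r' n)" for n
      using seq_suble[OF r, of "r' n"] seq_suble[OF r', of n] by linarith
    then have "\<exists>M. \<forall>m\<ge>M. \<forall>n\<ge>M. gagliardo_norm s p (\<lambda>x. v m x - v n x) < e" if "0 < e" for e
      using \<phi> that unfolding cauchy_tests_def v_def mem_Collect_eq by (meson order_trans)
    then show ?thesis
      using vt unfolding cauchy_tests_def by blast
  qed
  have "AE x in lebesgue. (\<lambda>n. v n x) \<longlonglongrightarrow> u x"
    using ae uX
  proof eventually_elim
    case (elim x)
    have "(\<lambda>k. d (r' k) x + indicator \<Omega> x *\<^sub>R J X x) \<longlonglongrightarrow> 0 + indicator \<Omega> x *\<^sub>R J X x"
      using elim by (intro tendsto_add tendsto_const) auto
    moreover have "indicator \<Omega> x *\<^sub>R J X x = u x" using elim out by (auto simp: indicator_def)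
    ultimately show ?case by (simp add: d_def v_def)
  qed
  then have aeu: "AE x in lborel. (\<lambda>n. v n x) \<longlonglongrightarrow> u x" by (simp add: AE_completion_iff)
  define u' where "u' = (\<lambda>x. lim (\<lambda>n. v n x))"
  have u'b [measurable]: "u' \<in> borel_measurable borel" unfolding u'_def by measurable
  have uu': "AE x in lborel. u x = u' x"
    using aeu by eventually_elim (simp add: u'_def limI)
  have aeu': "AE x in lborel. (\<lambda>n. v n x) \<longlonglongrightarrow> u' x"
    using aeu uu' by eventually_elim simp
  note E = cauchy_tests_energy_limit[OF p s vc u'b aeu']
  have "gagliardo_energy s p u = gagliardo_energy s p u'"
    by (rule gagliardo_energy_cong_AE[OF uu'])
  then have "gagliardo_energy s p u < \<infinity>" "(\<lambda>n. gagliardo_norm s p (v n)) \<longlonglongrightarrow> gagliardo_norm s p u"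
    using E by (simp_all add: gagliardo_norm_def)
  moreover have "set_integrable lebesgue \<Omega> u"
  proof -
    have ae: "AE x in lebesgue. indicator \<Omega> x *\<^sub>R J X x = u x"
      using uX by eventually_elim (use out in \<open>auto simp: indicator_def\<close>)
    then have 1: "u \<in> borel_measurable lebesgue"
      by (rule borel_measurable_AE[OF borel_measurable_integrable[OF Jint]])
    have "integrable lebesgue u"
      using integrable_cong_AE[OF borel_measurable_integrable[OF Jint] 1 ae] Jint by simp
    moreover have "(\<lambda>x. indicator \<Omega> x *\<^sub>R u x) = u" using out by (auto simp: indicator_def fun_eq_iff)
    ultimately show ?thesis by (simp add: set_integrable_def)
  qed
  ultimately show ?thesis using vt u'b uu' aeu' by blast
qed

section \<open>The torsion function\<close>

lemma test_function_in_D0_functions: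
  assumes J: "compact_embedding s p \<Omega> J" and f: "f \<in> test_functions \<Omega>"
  shows "f \<in> D0_functions s p \<Omega> J"
proof -
  have "AE x in lebesgue. x \<in> \<Omega> \<longrightarrow> J (D0_class s p \<Omega> (\<lambda>n. f)) x = f x"
    using J f unfolding compact_embedding_def by blast
  then have "AE x in lebesgue. x \<in> \<Omega> \<longrightarrow> f x = J (D0_class s p \<Omega> (\<lambda>n. f)) x"
    by eventually_elim simp
  moreover have "D0_class s p \<Omega> (\<lambda>n. f) \<in> D0 s p \<Omega>"
    by (intro D0_class_in_D0 constant_cauchy_tests f)
  ultimately show ?thesis
    unfolding D0_functions_def using test_function_outside[OF f] by blast
qed

lemma torsion_functional_eq:
  assumes p: "1 < p" and fin: "gagliardo_energy s p u < \<infinity>"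
  shows "torsion_functional s p \<Omega> u
    = ereal (gagliardo_norm s p u powr p / p - (LINT x:\<Omega>|lebesgue. u x))"
  unfolding torsion_functional_def gagliardo_energy_eq_norm[OF assms]
  by (simp add: enn2ereal_ennreal)

text \<open>The pointwise contraction property of \<open>smooth_lp\<close>, integrated against the kernel.\<close>

lemma smooth_lp_energy:
  fixes f g :: "'a::euclidean_space \<Rightarrow> real"
  assumes p: "1 < p" and t: "0 \<le> t"
    and [measurable]: "f \<in> borel_measurable borel" "g \<in> borel_measurable borel"
  shows "gagliardo_energy s p (\<lambda>x. smooth_lp p t e (f x) (g x) - c)
    \<le> gagliardo_energy s p f + ennreal t * gagliardo_energy s p g"
proof -
  have "gagliardo_integrand s p (\<lambda>x. smooth_lp p t e (f x) (g x) - c) z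
      \<le> gagliardo_integrand s p f z + ennreal t * gagliardo_integrand s p g z" for z
  proof -
    define K where "K = norm (fst z - snd z) powr (real DIM('a) + s * p)"
    have "\<bar>smooth_lp p t e (f (fst z)) (g (fst z)) - smooth_lp p t e (f (snd z)) (g (snd z))\<bar> powr p / K
        \<le> (\<bar>f (fst z) - f (snd z)\<bar> powr p + t * \<bar>g (fst z) - g (snd z)\<bar> powr p) / K"
      by (intro divide_right_mono smooth_lp_contraction p t) (simp add: K_def)
    also have "\<dots> = \<bar>f (fst z) - f (snd z)\<bar> powr p / K + t * (\<bar>g (fst z) - g (snd z)\<bar> powr p / K)"
      by (simp add: add_divide_distrib)
    finally show ?thesis
      unfolding gagliardo_integrand_def K_def[symmetric] using t
      by (simp add: K_def flip: ennreal_mult ennreal_plus)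
  qed
  then have "gagliardo_energy s p (\<lambda>x. smooth_lp p t e (f x) (g x) - c)
      \<le> (\<integral>\<^sup>+z. gagliardo_integrand s p f z + ennreal t * gagliardo_integrand s p g z \<partial>(lborel \<Otimes>\<^sub>M lborel))"
    unfolding gagliardo_energy_lborel by (intro nn_integral_mono)
  also have "\<dots> = gagliardo_energy s p f + ennreal t * gagliardo_energy s p g"
    unfolding gagliardo_energy_lborel by (simp add: nn_integral_add nn_integral_cmult)
  finally show ?thesis .
qed

text \<open>The competitors \<open>\<sigma> n\<close> are test functions that approximate \<open>(\<bar>w\<bar> powr p + t * \<bar>u\<bar> powr p) powr (1 / p)\<close>. Their
  energies exceed those of the approximants \<open>\<phi> n\<close> of \<open>w\<close> by at most \<open>t\<close> times those of the approximants
  \<open>\<psi> n\<close> of \<open>u\<close>. So in the inequality between the values of the torsion functional at \<open>w\<close> and at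
  \<open>\<sigma> n\<close> the energy of \<open>w\<close> cancels in the limit. As \<open>\<sigma> n\<close> is nonnegative, Fatou passes the remaining
  integral to the limit. Minimality is thus invoked at test functions, whose membership in
  the completion is immediate.\<close>

lemma torsion_minimality:
  fixes \<Omega> :: "'a::euclidean_space set"
  assumes p: "1 < p" and s: "0 < s" "s < 1" and \<Omega>: "open \<Omega>"
    and J: "compact_embedding s p \<Omega> J" and w: "torsion_function s p \<Omega> J w"
    and u: "u \<in> D0_functions s p \<Omega> J" and t: "0 \<le> t"
  shows "(\<integral>\<^sup>+x\<in>\<Omega>. ennreal ((\<bar>w x\<bar> powr p + t * \<bar>u x\<bar> powr p) powr (1 / p)) \<partial>lebesgue)
    \<le> ennreal ((LINT x:\<Omega>|lebesgue. w x) + t / p * gagliardo_norm s p u powr p)"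
proof -
  let ?g = "gagliardo_norm s p" and ?E = "gagliardo_energy s p"
  have wD: "w \<in> D0_functions s p \<Omega> J" using w by (simp add: torsion_function_def)
  obtain \<phi> w' where \<phi>: "\<And>n. \<phi> n \<in> test_functions \<Omega>"
    and w': "w' \<in> borel_measurable borel" "AE x in lborel. w x = w' x"
    and \<phi>w: "AE x in lborel. (\<lambda>n. \<phi> n x) \<longlonglongrightarrow> w' x"
    and wfin: "?E w < \<infinity>" and \<phi>E: "(\<lambda>n. ?g (\<phi> n)) \<longlonglongrightarrow> ?g w"
    using D0_functions_approx[OF p s \<Omega> J wD] by blast
  obtain \<psi> u' where \<psi>: "\<And>n. \<psi> n \<in> test_functions \<Omega>"
    and u': "u' \<in> borel_measurable borel" "AE x in lborel. u x = u' x"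
    and \<psi>u: "AE x in lborel. (\<lambda>n. \<psi> n x) \<longlonglongrightarrow> u' x"
    and \<psi>E: "(\<lambda>n. ?g (\<psi> n)) \<longlonglongrightarrow> ?g u"
    using D0_functions_approx[OF p s \<Omega> J u] by blast
  define I where "I = (LINT x:\<Omega>|lebesgue. w x)"
  define e where "e = (\<lambda>n. 1 / real (Suc n))"
  have e0: "e n \<noteq> 0" for n by (simp add: e_def)
  have e_lim: "e \<longlonglongrightarrow> 0"
    unfolding e_def using LIMSEQ_inverse_real_of_nat by (simp add: inverse_eq_divide)
  define \<sigma> where "\<sigma> = (\<lambda>n x. smooth_lp p t (e n) (\<phi> n x) (\<psi> n x) - smooth_lp p t (e n) 0 0)"
  have \<sigma>t: "\<sigma> n \<in> test_functions \<Omega>" for n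
    unfolding \<sigma>_def by (intro test_functions_smooth_lp \<phi> \<psi> e0 t)
  have \<sigma>0: "0 \<le> \<sigma> n x" for n x
    unfolding \<sigma>_def using smooth_lp_minimal[OF p t] by simp
  have \<sigma>b [measurable]: "\<sigma> n \<in> borel_measurable borel" for n by (rule test_function_borel[OF \<sigma>t])
  have [measurable]: "\<Omega> \<in> sets borel" using \<Omega> by simp
  have set_nn: "(\<integral>\<^sup>+x\<in>\<Omega>. ennreal (\<sigma> n x) \<partial>lebesgue) = ennreal (LINT x:\<Omega>|lebesgue. \<sigma> n x)" for n
  proof -
    have eq: "(\<lambda>x. indicator \<Omega> x *\<^sub>R \<sigma> n x) = \<sigma> n"
      using test_function_outside[OF \<sigma>t] by (auto simp: indicator_def fun_eq_iff)
    have "(\<integral>\<^sup>+x\<in>\<Omega>. ennreal (\<sigma> n x) \<partial>lebesgue) = (\<integral>\<^sup>+x. ennreal (\<sigma> n x) \<partial>lebesgue)"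
      using test_function_outside[OF \<sigma>t] by (intro nn_integral_cong) (auto simp: indicator_def)
    also have "\<dots> = ennreal (\<integral>x. \<sigma> n x \<partial>lebesgue)"
      by (intro nn_integral_eq_integral test_function_integrable[OF \<sigma>t]) (simp add: \<sigma>0)
    finally show ?thesis unfolding set_lebesgue_integral_def eq .
  qed
  define R where "R = (\<lambda>n. I + (?g (\<phi> n) powr p - ?g w powr p) / p + t / p * ?g (\<psi> n) powr p)"
  have le: "(LINT x:\<Omega>|lebesgue. \<sigma> n x) \<le> R n" for n
  proof -
    have "?E (\<sigma> n) \<le> ?E (\<phi> n) + ennreal t * ?E (\<psi> n)"
      unfolding \<sigma>_def by (intro smooth_lp_energy p t test_function_borel[OF \<phi>] test_function_borel[OF \<psi>])
    also have "\<dots> = ennreal (?g (\<phi> n) powr p + t * ?g (\<psi> n) powr p)"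
      using t by (simp add: gagliardo_energy_eq_norm[OF p test_function_energy_finite[OF p s \<phi>]]
          gagliardo_energy_eq_norm[OF p test_function_energy_finite[OF p s \<psi>]] ennreal_mult)
    finally have "ennreal (?g (\<sigma> n) powr p) \<le> ennreal (?g (\<phi> n) powr p + t * ?g (\<psi> n) powr p)"
      unfolding gagliardo_energy_eq_norm[OF p test_function_energy_finite[OF p s \<sigma>t]] .
    then have "?g (\<sigma> n) powr p \<le> ?g (\<phi> n) powr p + t * ?g (\<psi> n) powr p"
      using t by (subst (asm) ennreal_le_iff) auto
    then have le1: "?g (\<sigma> n) powr p / p \<le> (?g (\<phi> n) powr p + t * ?g (\<psi> n) powr p) / p"
      using p by (intro divide_right_mono) auto
    have "torsion_functional s p \<Omega> w \<le> torsion_functional s p \<Omega> (\<sigma> n)"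
      using w test_function_in_D0_functions[OF J \<sigma>t] unfolding torsion_function_def by blast
    then have "?g w powr p / p - I \<le> ?g (\<sigma> n) powr p / p - (LINT x:\<Omega>|lebesgue. \<sigma> n x)"
      unfolding torsion_functional_eq[OF p wfin] torsion_functional_eq[OF p test_function_energy_finite[OF p s \<sigma>t]]
      by (simp add: I_def)
    with le1 show ?thesis by (simp add: R_def add_divide_distrib diff_divide_distrib)
  qed
  have "R \<longlonglongrightarrow> I + (?g w powr p - ?g w powr p) / p + t / p * ?g u powr p"
    unfolding R_def divide_inverse using p
    by (intro tendsto_intros tendsto_powr2 \<phi>E \<psi>E) (auto simp: gagliardo_norm_nonneg)
  then have R: "R \<longlonglongrightarrow> I + t / p * ?g u powr p" by simp
  have conv: "AE x in lborel. ennreal ((\<bar>w x\<bar> powr p + t * \<bar>u x\<bar> powr p) powr (1 / p)) * indicator \<Omega> x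
      = liminf (\<lambda>n. ennreal (\<sigma> n x) * indicator \<Omega> x)"
    using w'(2) u'(2) \<phi>w \<psi>u
  proof eventually_elim
    case (elim x)
    have "(\<lambda>n. smooth_lp p t (e n) 0 0) \<longlonglongrightarrow> (\<bar>0\<bar> powr p + t * \<bar>0\<bar> powr p) powr (1 / p)"
      by (intro smooth_lp_tendsto p t e_lim tendsto_const)
    then have 0: "(\<lambda>n. smooth_lp p t (e n) 0 0) \<longlonglongrightarrow> 0" by simp
    have "(\<lambda>n. smooth_lp p t (e n) (\<phi> n x) (\<psi> n x)) \<longlonglongrightarrow> (\<bar>w' x\<bar> powr p + t * \<bar>u' x\<bar> powr p) powr (1 / p)"
      using elim by (intro smooth_lp_tendsto p t e_lim) auto
    from tendsto_diff[OF this 0] have "(\<lambda>n. \<sigma> n x) \<longlonglongrightarrow> (\<bar>w x\<bar> powr p + t * \<bar>u x\<bar> powr p) powr (1 / p)"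
      using elim by (simp add: \<sigma>_def)
    then have "(\<lambda>n. ennreal (\<sigma> n x) * indicator \<Omega> x)
        \<longlonglongrightarrow> ennreal ((\<bar>w x\<bar> powr p + t * \<bar>u x\<bar> powr p) powr (1 / p)) * indicator \<Omega> x"
      by (cases "x \<in> \<Omega>") (auto intro: tendsto_ennrealI)
    then show ?case by (simp add: lim_imp_Liminf)
  qed
  have "(\<integral>\<^sup>+x\<in>\<Omega>. ennreal ((\<bar>w x\<bar> powr p + t * \<bar>u x\<bar> powr p) powr (1 / p)) \<partial>lebesgue)
      = (\<integral>\<^sup>+x. liminf (\<lambda>n. ennreal (\<sigma> n x) * indicator \<Omega> x) \<partial>lborel)"
    unfolding nn_integral_completion by (rule nn_integral_cong_AE[OF conv])
  also have "\<dots> \<le> liminf (\<lambda>n. \<integral>\<^sup>+x\<in>\<Omega>. ennreal (\<sigma> n x) \<partial>lborel)"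
    by (intro nn_integral_liminf) measurable
  also have "\<dots> = liminf (\<lambda>n. ennreal (LINT x:\<Omega>|lebesgue. \<sigma> n x))"
    unfolding set_nn[unfolded nn_integral_completion] ..
  also have "\<dots> \<le> liminf (\<lambda>n. ennreal (R n))"
    by (intro Liminf_mono always_eventually allI ennreal_leI le)
  also have "\<dots> = ennreal (I + t / p * ?g u powr p)"
    by (intro lim_imp_Liminf tendsto_ennrealI R) simp
  finally show ?thesis by (simp add: I_def)
qed

lemma tendsto_inverse_ennreal:
  fixes f :: "nat \<Rightarrow> ennreal"
  assumes "f \<longlonglongrightarrow> l"
  shows "(\<lambda>n. inverse (f n)) \<longlonglongrightarrow> inverse l"
  using continuous_on_tendsto_compose[OF continuous_on_inverse_ennreal[OF continuous_on_id, of UNIV] assms] by simp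

text \<open>For \<open>a = 0\<close> and \<open>b \<noteq> 0\<close> the limit is \<open>\<infinity>\<close>, in agreement with division by \<open>0\<close> in \<open>ennreal\<close>;
  for \<open>b = 0\<close> both sides are \<open>0\<close>.\<close>

lemma hardy_quotient_tendsto:
  fixes a b :: real
  assumes p: "1 < p" and a: "0 \<le> a" and t: "t \<longlonglongrightarrow> 0" and t0: "\<And>n. 0 < t n"
  shows "(\<lambda>n. ennreal (\<bar>b\<bar> powr p / (a powr p + t n * \<bar>b\<bar> powr p) powr ((p - 1) / p)))
    \<longlonglongrightarrow> ennreal (\<bar>b\<bar> powr p) / ennreal (a powr (p - 1))"
proof (cases "b = 0")
  case True
  then show ?thesis by simp
next
  case False
  let ?d = "\<lambda>n. (a powr p + t n * \<bar>b\<bar> powr p) powr ((p - 1) / p)"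
  have nn: "0 \<le> a powr p + t n * \<bar>b\<bar> powr p" for n
    using t0[of n] by simp
  have d0: "0 < ?d n" for n
  proof -
    have "0 < a powr p + t n * \<bar>b\<bar> powr p"
      using False t0[of n] by (intro add_nonneg_pos mult_pos_pos) auto
    then show ?thesis by (metis powr_gt_zero less_irrefl)
  qed
  have "?d \<longlonglongrightarrow> (a powr p + 0 * \<bar>b\<bar> powr p) powr ((p - 1) / p)"
    using p nn by (intro tendsto_powr2 tendsto_intros t) auto
  then have "?d \<longlonglongrightarrow> a powr (p - 1)" using p by (simp add: powr_powr)
  then have "(\<lambda>n. inverse (ennreal (?d n))) \<longlonglongrightarrow> inverse (ennreal (a powr (p - 1)))"
    by (intro tendsto_inverse_ennreal tendsto_ennrealI)
  then have "(\<lambda>n. ennreal (\<bar>b\<bar> powr p) * inverse (ennreal (?d n)))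
      \<longlonglongrightarrow> ennreal (\<bar>b\<bar> powr p) * inverse (ennreal (a powr (p - 1)))"
    using False by (intro tendsto_mult_ennreal tendsto_const) auto
  then show ?thesis
    using d0 by (simp add: divide_ennreal_def flip: divide_ennreal)
qed

theorem proposition4p1:
  fixes s p :: real
    and \<Omega> :: "'a::euclidean_space set"
    and J :: "(nat \<Rightarrow> 'a \<Rightarrow> real) set \<Rightarrow> 'a \<Rightarrow> real"
    and w :: "'a \<Rightarrow> real"
  assumes "1 < p" and "0 < s" and "s < 1"
    and "open \<Omega>"
    and "compact_embedding s p \<Omega> J"
    and "torsion_function s p \<Omega> J w"
  shows "\<forall>u\<in>D0_functions s p \<Omega> J.
    (\<integral>\<^sup>+x\<in>\<Omega>. (ennreal (\<bar>u x\<bar> powr p) / ennreal (w x powr (p - 1))) \<partial>lebesgue)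
      \<le> (\<integral>\<^sup>+(x, y). ennreal (\<bar>u x - u y\<bar> powr p / norm (x - y) powr (real DIM('a) + s * p))
            \<partial>(lebesgue :: ('a \<times> 'a) measure))"
proof
  fix u assume u: "u \<in> D0_functions s p \<Omega> J"
  note p = assms(1) and s = assms(2,3) and \<Omega> = assms(4) and J = assms(5) and w = assms(6)
  have wD: "w \<in> D0_functions s p \<Omega> J" using w by (simp add: torsion_function_def)
  have [measurable]: "\<Omega> \<in> sets borel" using \<Omega> by simp
  obtain w' where wb [measurable]: "w' \<in> borel_measurable borel" and ww': "AE x in lborel. w x = w' x"
    and wint: "set_integrable lebesgue \<Omega> w"
    using D0_functions_approx[OF p s \<Omega> J wD] by blast
  obtain u' where ub [measurable]: "u' \<in> borel_measurable borel" and uu': "AE x in lborel. u x = u' x"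
    and ufin: "gagliardo_energy s p u < \<infinity>"
    using D0_functions_approx[OF p s \<Omega> J u] by blast
  define I where "I = (LINT x:\<Omega>|lebesgue. w x)"
  define e where "e = gagliardo_norm s p u powr p"
  let ?S = "\<lambda>t x. (\<bar>w' x\<bar> powr p + t * \<bar>u' x\<bar> powr p) powr (1 / p)"
  have min: "(\<integral>\<^sup>+x\<in>\<Omega>. ennreal (?S t x) \<partial>lborel) \<le> ennreal (I + t / p * e)" if "0 \<le> t" for t
  proof -
    have "(\<integral>\<^sup>+x\<in>\<Omega>. ennreal (?S t x) \<partial>lborel)
        = (\<integral>\<^sup>+x\<in>\<Omega>. ennreal ((\<bar>w x\<bar> powr p + t * \<bar>u x\<bar> powr p) powr (1 / p)) \<partial>lborel)"
      by (rule nn_integral_cong_AE) (use ww' uu' in eventually_elim, simp)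
    then show ?thesis
      using torsion_minimality[OF p s \<Omega> J w u that] by (simp add: nn_integral_completion I_def e_def)
  qed
  have w'int: "integrable lborel (\<lambda>x. indicator \<Omega> x *\<^sub>R w' x)" and I_eq: "I = (\<integral>x. indicator \<Omega> x *\<^sub>R w' x \<partial>lborel)"
  proof -
    have m: "(\<lambda>x. indicator \<Omega> x *\<^sub>R w' x) \<in> borel_measurable lborel" by measurable
    have ae: "AE x in lebesgue. indicator \<Omega> x *\<^sub>R w x = indicator \<Omega> x *\<^sub>R w' x"
    proof (rule AE_completion)
      show "AE x in lborel. indicator \<Omega> x *\<^sub>R w x = indicator \<Omega> x *\<^sub>R w' x"
        using ww' by eventually_elim simp
    qed
    have w1: "integrable lebesgue (\<lambda>x. indicator \<Omega> x *\<^sub>R w x)" using wint by (simp add: set_integrable_def)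
    have "integrable lebesgue (\<lambda>x. indicator \<Omega> x *\<^sub>R w' x)"
      using integrable_cong_AE[OF borel_measurable_integrable[OF w1] measurable_completion[OF m] ae] w1 by simp
    then show "integrable lborel (\<lambda>x. indicator \<Omega> x *\<^sub>R w' x)" using m by (simp add: integrable_completion)
    have "I = (\<integral>x. indicator \<Omega> x *\<^sub>R w' x \<partial>lebesgue)"
      unfolding I_def set_lebesgue_integral_def
      by (rule integral_cong_AE[OF borel_measurable_integrable[OF w1] measurable_completion[OF m] ae])
    then show "I = (\<integral>x. indicator \<Omega> x *\<^sub>R w' x \<partial>lborel)" using m by (simp add: integral_completion)
  qed
  \<comment> \<open>Minimality with \<open>t = 0\<close> compares the integral of \<open>\<bar>w\<bar>\<close> with that of \<open>w\<close>.\<close>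
  have w_nonneg: "AE x in lborel. x \<in> \<Omega> \<longrightarrow> 0 \<le> w' x"
  proof -
    let ?v = "\<lambda>x. indicator \<Omega> x *\<^sub>R w' x"
    have abs_int: "integrable lborel (\<lambda>x. \<bar>?v x\<bar>)" using w'int by (rule integrable_abs)
    have "ennreal (\<integral>x. \<bar>?v x\<bar> \<partial>lborel) = (\<integral>\<^sup>+x. ennreal \<bar>?v x\<bar> \<partial>lborel)"
      by (rule nn_integral_eq_integral[symmetric, OF abs_int]) simp
    also have "\<dots> = (\<integral>\<^sup>+x\<in>\<Omega>. ennreal (?S 0 x) \<partial>lborel)"
      using p by (intro nn_integral_cong) (auto simp: indicator_def powr_powr)
    also have "\<dots> \<le> ennreal I" using min[of 0] by simp
    finally have "(\<integral>x. \<bar>?v x\<bar> \<partial>lborel) \<le> max 0 I" by (auto simp: ennreal_le_iff2)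
    moreover have I_le: "\<bar>I\<bar> \<le> (\<integral>x. \<bar>?v x\<bar> \<partial>lborel)"
      unfolding I_eq by (rule integral_abs_bound)
    ultimately have "(\<integral>x. \<bar>?v x\<bar> \<partial>lborel) = I" by linarith
    then have "(\<integral>x. \<bar>?v x\<bar> - ?v x \<partial>lborel) = 0"
      using w'int abs_int by (simp add: I_eq)
    moreover have "integrable lborel (\<lambda>x. \<bar>?v x\<bar> - ?v x)"
      using w'int abs_int by (rule Bochner_Integration.integrable_diff[rotated])
    ultimately have "AE x in lborel. \<bar>?v x\<bar> - ?v x = 0"
      by (subst (asm) integral_nonneg_eq_0_iff_AE) auto
    then show ?thesis
      by eventually_elim (auto simp: indicator_def split: if_splits)
  qed
  have I_nn: "(\<integral>\<^sup>+x\<in>\<Omega>. ennreal (w' x) \<partial>lborel) = ennreal I" and I0: "0 \<le> I"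
  proof -
    have ae: "AE x in lborel. 0 \<le> indicator \<Omega> x *\<^sub>R w' x"
      using w_nonneg by eventually_elim (auto simp: indicator_def)
    have "(\<integral>\<^sup>+x\<in>\<Omega>. ennreal (w' x) \<partial>lborel) = (\<integral>\<^sup>+x. ennreal (indicator \<Omega> x *\<^sub>R w' x) \<partial>lborel)"
      by (intro nn_integral_cong) (auto simp: indicator_def)
    also have "\<dots> = ennreal I" unfolding I_eq by (rule nn_integral_eq_integral[OF w'int ae])
    finally show "(\<integral>\<^sup>+x\<in>\<Omega>. ennreal (w' x) \<partial>lborel) = ennreal I" .
    show "0 \<le> I" unfolding I_eq by (rule integral_nonneg_AE[OF ae])
  qed
  let ?Q = "\<lambda>t x. \<bar>u' x\<bar> powr p / (w' x powr p + t * \<bar>u' x\<bar> powr p) powr ((p - 1) / p)"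
  \<comment> \<open>Minimality bounds the integral of \<open>S - w\<close> by \<open>t / p * e\<close>, and \<open>t / p * Q \<le> S - w\<close>; the factor cancels.\<close>
  have Q_le: "(\<integral>\<^sup>+x\<in>\<Omega>. ennreal (?Q t x) \<partial>lborel) \<le> ennreal e" if t: "0 < t" for t
  proof -
    let ?D = "\<lambda>x. ennreal (?S t x - w' x)"
    have "(\<integral>\<^sup>+x\<in>\<Omega>. ennreal (w' x) \<partial>lborel) + (\<integral>\<^sup>+x\<in>\<Omega>. ?D x \<partial>lborel)
        = (\<integral>\<^sup>+x. ennreal (w' x) * indicator \<Omega> x + ?D x * indicator \<Omega> x \<partial>lborel)"
      by (rule nn_integral_add[symmetric]) measurable
    also have "\<dots> = (\<integral>\<^sup>+x\<in>\<Omega>. ennreal (?S t x) \<partial>lborel)"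
    proof (rule nn_integral_cong_AE)
      show "AE x in lborel. ennreal (w' x) * indicator \<Omega> x + ?D x * indicator \<Omega> x = ennreal (?S t x) * indicator \<Omega> x"
        using w_nonneg
      proof eventually_elim
        case (elim x)
        show ?case
        proof (cases "x \<in> \<Omega>")
          case True
          then have w0: "0 \<le> w' x" using elim by simp
          have "w' x = (w' x powr p) powr (1 / p)" using p w0 by (simp add: powr_powr)
          also have "\<dots> \<le> ?S t x"
            using p t w0 by (intro powr_mono2) auto
          finally show ?thesis using True w0 by (simp flip: ennreal_plus)
        qed simp
      qed
    qed
    also have "\<dots> \<le> ennreal (I + t / p * e)" using min[of t] t by simp
    also have "\<dots> = ennreal I + ennreal (t / p * e)"
      using I0 t p by (simp add: e_def)
    finally have "(\<integral>\<^sup>+x\<in>\<Omega>. ?D x \<partial>lborel) \<le> ennreal (t / p * e)"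
      unfolding I_nn by (simp add: ennreal_add_left_cancel_le)
    then have D_le: "ennreal (p / t) * (\<integral>\<^sup>+x\<in>\<Omega>. ?D x \<partial>lborel) \<le> ennreal (p / t) * ennreal (t / p * e)"
      by (rule mult_left_mono) simp
    have "(\<integral>\<^sup>+x\<in>\<Omega>. ennreal (?Q t x) \<partial>lborel) \<le> (\<integral>\<^sup>+x. ennreal (p / t) * (?D x * indicator \<Omega> x) \<partial>lborel)"
    proof (rule nn_integral_mono_AE)
      show "AE x in lborel. ennreal (?Q t x) * indicator \<Omega> x \<le> ennreal (p / t) * (?D x * indicator \<Omega> x)"
        using w_nonneg
      proof eventually_elim
        case (elim x)
        show ?case
        proof (cases "x \<in> \<Omega>")
          case True
          then have w0: "0 \<le> w' x" using elim by simp
          have "p / t * (t / p * ?Q t x) \<le> p / t * (?S t x - w' x)"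
            using lp_increment_lower[OF p t w0, of "u' x"] p t w0 by (intro mult_left_mono) auto
          then have "?Q t x \<le> p / t * (?S t x - w' x)" using p t by simp
          then have "ennreal (?Q t x) \<le> ennreal (p / t * (?S t x - w' x))" by (rule ennreal_leI)
          also have "\<dots> = ennreal (p / t) * ?D x" using p t by (intro ennreal_mult') simp
          finally show ?thesis using True by simp
        qed simp
      qed
    qed
    also have "\<dots> = ennreal (p / t) * (\<integral>\<^sup>+x\<in>\<Omega>. ?D x \<partial>lborel)"
      by (rule nn_integral_cmult) measurable
    also have "\<dots> \<le> ennreal (p / t) * ennreal (t / p * e)" by (rule D_le)
    also have "\<dots> = ennreal e" using p t by (simp flip: ennreal_mult' add: e_def)
    finally show ?thesis .
  qed
  define t where "t = (\<lambda>n. 1 / real (Suc n))"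
  have t0: "0 < t n" for n by (simp add: t_def)
  have t_lim: "t \<longlonglongrightarrow> 0"
    unfolding t_def using LIMSEQ_inverse_real_of_nat by (simp add: inverse_eq_divide)
  have "(\<integral>\<^sup>+x\<in>\<Omega>. (ennreal (\<bar>u x\<bar> powr p) / ennreal (w x powr (p - 1))) \<partial>lebesgue)
      = (\<integral>\<^sup>+x. liminf (\<lambda>n. ennreal (?Q (t n) x) * indicator \<Omega> x) \<partial>lborel)"
    unfolding nn_integral_completion
  proof (rule nn_integral_cong_AE)
    show "AE x in lborel. ennreal (\<bar>u x\<bar> powr p) / ennreal (w x powr (p - 1)) * indicator \<Omega> x
        = liminf (\<lambda>n. ennreal (?Q (t n) x) * indicator \<Omega> x)"
      using w_nonneg ww' uu'
    proof eventually_elim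
      case (elim x)
      show ?case
      proof (cases "x \<in> \<Omega>")
        case True
        then have "(\<lambda>n. ennreal (?Q (t n) x)) \<longlonglongrightarrow> ennreal (\<bar>u' x\<bar> powr p) / ennreal (w' x powr (p - 1))"
          using elim by (intro hardy_quotient_tendsto p t_lim t0) auto
        then show ?thesis using True elim by (simp add: lim_imp_Liminf)
      qed (simp add: Liminf_const)
    qed
  qed
  also have "\<dots> \<le> liminf (\<lambda>n. \<integral>\<^sup>+x\<in>\<Omega>. ennreal (?Q (t n) x) \<partial>lborel)"
    by (intro nn_integral_liminf) measurable
  also have "\<dots> \<le> liminf (\<lambda>n::nat. ennreal e)"
    by (intro Liminf_mono always_eventually allI Q_le t0)
  also have "\<dots> = ennreal e" by (simp add: Liminf_const)
  also have "\<dots> = gagliardo_energy s p u"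
    unfolding e_def by (rule gagliardo_energy_eq_norm[OF p ufin, symmetric])
  finally show "(\<integral>\<^sup>+x\<in>\<Omega>. (ennreal (\<bar>u x\<bar> powr p) / ennreal (w x powr (p - 1))) \<partial>lebesgue)
      \<le> (\<integral>\<^sup>+(x, y). ennreal (\<bar>u x - u y\<bar> powr p / norm (x - y) powr (real DIM('a) + s * p))
            \<partial>(lebesgue :: ('a \<times> 'a) measure))"
    unfolding gagliardo_energy_def .
qed

end
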